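(* Fix the domain $[n]^2$, let $p\ge1$, let $\mathsf{dist}$ be the normalized $\ell_p$ metric on $[n]^2$, and let $0<\Delta<\epsilon-\frac8n$ satisfy $\Delta\le\epsilon/8$. Then there is a $(\mathsf{CC},\mathcal B,\Delta)$-diameter-guarded $\epsilon$-tester for equivalence under $\mathsf{EMD}_{\mathsf{dist}}$ using at most $m(\epsilon)=\widetilde O(\epsilon^{-2})$ samples and $q(\epsilon)=O(\frac1\epsilon\log n)$ queries, where $\widetilde O(\cdot)$ hides polylogarithmic factors in $1/\epsilon$.
   Context: The normalized $\ell_p$ metric on $[n]^2$ is $\mathsf{dist}(x,y)=\|x-y\|_p/(2^{1/p}n)$. For distributions $\mu,\nu$, $\mathsf{EMD}_{\mathsf{dist}}(\mu,\nu)=\inf_\pi\mathbb{E}_{(x,y)\sim\pi}[\mathsf{dist}(x,y)]$ over couplings $\pi$ of $\mu,\nu$. A clustering of a domain $\mathcal X$ is a pair $(\Gamma,\mathsf{rep})$ where $\Gamma=\{\Gamma_1,\dots,\Gamma_k\}$ partitions $\mathcal X$ into cells and $\mathsf{rep}(i)\in\Gamma_i$; $\gamma(x)$ is the index of the cell containing $x$. For a distribution $\mu$ the clustered-sample oracle returns independent samples $\mathsf{rep}(\gamma(x))$, $x\sim\mu$; the label oracle on query $x$ returns $\mathsf{rep}(\gamma(x))$. Samples are calls to clustered-sample oracles, queries are calls to the label oracle. $\mathsf{CC}$ is the class of clusterings of $[n]^2$ each of whose cells is connected in the grid graph on $[n]^2$ (edges between $x,y$ with $\|x-y\|_1=1$)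 and convex (equal to the set of points of $[n]^2$ in its convex hull); $\mathcal B\subseteq\mathsf{CC}$ is the class of clusterings whose cells are axis-aligned boxes $\{x: a_i\le x_i\le b_i\}$. Let $c=\frac{1}{384\ln 24}$. An algorithm is a $(\mathcal U,\mathcal G,\Delta)$-diameter-guarded $\epsilon$-tester for equivalence if, given clustered-sample oracles for two unknown distributions $\mu,\nu$ under the same clustering and the label oracle, it outputs ACCEPT, REJECT or CLUSTER-REJECT and, for every input with $(\Gamma,\mathsf{rep})\in\mathcal U$: (1) if $(\Gamma,\mathsf{rep})\in\mathcal G$ and both $\Pr_{x\sim\mu}[\mathrm{diam}_{\mathsf{dist}}(\Gamma_{\gamma(x)})>\Delta]\le c\epsilon$ and $\Pr_{x\sim\nu}[\mathrm{diam}_{\mathsf{dist}}(\Gamma_{\gamma(x)})>\Delta]\le c\epsilon$, it outputs CLUSTER-REJECT with probability at most $1/6$; (2) if $\mu=\nu$ it outputs ACCEPT or CLUSTER-REJECT with probability at least $5/6$; (3) if $\mathsf{EMD}_{\mathsf{dist}}(\mu,\nu)>\epsilon$ it outputs REJECT or CLUSTER-REJECT with probability at least $5/6$. *)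

theory Defs
  imports "HOL-Probability.Probability" "HOL-Library.Disjoint_Sets"
begin

section \<open>Earth mover's distance\<close>

definition couplings :: "'a pmf \<Rightarrow> 'a pmf \<Rightarrow> ('a \<times> 'a) pmf set" where
  "couplings \<mu> \<nu> = {\<pi>. map_pmf fst \<pi> = \<mu> \<and> map_pmf snd \<pi> = \<nu>}"

definition emd :: "('a \<Rightarrow> 'a \<Rightarrow> real) \<Rightarrow> 'a pmf \<Rightarrow> 'a pmf \<Rightarrow> real" where
  "emd d \<mu> \<nu> = (INF \<pi>\<in>couplings \<mu> \<nu>. measure_pmf.expectation \<pi> (\<lambda>(x, y). d x y))"

definition diam :: "('a \<Rightarrow> 'a \<Rightarrow> real) \<Rightarrow> 'a set \<Rightarrow> real" where
  "diam d S = (SUP (x, y)\<in>S \<times> S. d x y)"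

section \<open>Clusterings\<close>

text \<open>The cells of a partition serve as their own indices: a clustering is a set of cells with a
  choice of representative for each cell, and \<open>cell_of \<Gamma> x\<close> plays the role of both
  the index \<open>\<gamma>(x)\<close> and the cell it names. The values of the representative map on sets
  that are not cells are irrelevant.\<close>

type_synonym 'a clustering = "'a set set \<times> ('a set \<Rightarrow> 'a)"

definition clusterings :: "'a set \<Rightarrow> 'a clustering set" where
  "clusterings X = {(\<Gamma>, rep). partition_on X \<Gamma> \<and> (\<forall>C\<in>\<Gamma>. rep C \<in> C)}"

definition cell_of :: "'a set set \<Rightarrow> 'a \<Rightarrow> 'a set" where
  "cell_of \<Gamma> x = (THE C. C \<in> \<Gamma> \<and> x \<in> C)"

definition label :: "'a clustering \<Rightarrow> 'a \<Rightarrow> 'a" where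
  "label = (\<lambda>(\<Gamma>, rep) x. rep (cell_of \<Gamma> x))"

section \<open>Oracle algorithms\<close>

datatype verdict = Accept | Reject | Cluster_Reject

text \<open>A randomized, adaptive algorithm is a decision tree: it may draw a clustered sample from the
  first or the second distribution, query the label oracle, or use internal randomness (drawn from
  any discrete distribution), and continues depending on the answer.\<close>

datatype 'a algorithm =
    Output verdict
  | Sample_fst "'a \<Rightarrow> 'a algorithm"
  | Sample_snd "'a \<Rightarrow> 'a algorithm"
  | Query 'a "'a \<Rightarrow> 'a algorithm"
  | Random "nat pmf" "nat \<Rightarrow> 'a algorithm"

primrec run :: "('a \<Rightarrow> 'a) \<Rightarrow> 'a pmf \<Rightarrow> 'a pmf \<Rightarrow> 'a algorithm \<Rightarrow> verdict pmf" where
  "run lab \<mu> \<nu> (Output v) = return_pmf v"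
| "run lab \<mu> \<nu> (Sample_fst f) = bind_pmf \<mu> (\<lambda>x. run lab \<mu> \<nu> (f (lab x)))"
| "run lab \<mu> \<nu> (Sample_snd f) = bind_pmf \<nu> (\<lambda>x. run lab \<mu> \<nu> (f (lab x)))"
| "run lab \<mu> \<nu> (Query x f) = run lab \<mu> \<nu> (f (lab x))"
| "run lab \<mu> \<nu> (Random r f) = bind_pmf r (\<lambda>i. run lab \<mu> \<nu> (f i))"

text \<open>\<open>within_budget X A s q\<close>: on every branch, \<open>A\<close> makes at most \<open>s\<close> sample calls in total (to both
  sample oracles together) and at most \<open>q\<close> label queries, all of them to points of the domain
  \<open>X\<close>.\<close>

primrec within_budget :: "'a set \<Rightarrow> 'a algorithm \<Rightarrow> nat \<Rightarrow> nat \<Rightarrow> bool" where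
  "within_budget X (Output v) = (\<lambda>s q. True)"
| "within_budget X (Sample_fst f) = (\<lambda>s q. 0 < s \<and> (\<forall>y\<in>X. within_budget X (f y) (s - 1) q))"
| "within_budget X (Sample_snd f) = (\<lambda>s q. 0 < s \<and> (\<forall>y\<in>X. within_budget X (f y) (s - 1) q))"
| "within_budget X (Query x f) =
     (\<lambda>s q. x \<in> X \<and> 0 < q \<and> (\<forall>y\<in>X. within_budget X (f y) s (q - 1)))"
| "within_budget X (Random r f) = (\<lambda>s q. \<forall>i\<in>set_pmf r. within_budget X (f i) s q)"

section \<open>Diameter-guarded testers for equivalence\<close>

definition guard_const :: real where
  "guard_const = 1 / (384 * ln 24)"

definition diameter_guarded_tester ::
  "'a set \<Rightarrow> ('a \<Rightarrow> 'a \<Rightarrow> real) \<Rightarrow> 'a clustering set \<Rightarrow> 'a clustering set \<Rightarrow> real \<Rightarrow> real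
     \<Rightarrow> 'a algorithm \<Rightarrow> bool" where
  "diameter_guarded_tester X d \<U> \<G> \<Delta> \<epsilon> A \<longleftrightarrow>
     (\<forall>\<Gamma> rep \<mu> \<nu>. (\<Gamma>, rep) \<in> \<U> \<and> set_pmf \<mu> \<subseteq> X \<and> set_pmf \<nu> \<subseteq> X \<longrightarrow>
       (let out = run (label (\<Gamma>, rep)) \<mu> \<nu> A in
         ((\<Gamma>, rep) \<in> \<G>
            \<and> measure_pmf.prob \<mu> {x. diam d (cell_of \<Gamma> x) > \<Delta>} \<le> guard_const * \<epsilon>
            \<and> measure_pmf.prob \<nu> {x. diam d (cell_of \<Gamma> x) > \<Delta>} \<le> guard_const * \<epsilon>
          \<longrightarrow> measure_pmf.prob out {Cluster_Reject} \<le> 1 / 6) \<and>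
         (\<mu> = \<nu> \<longrightarrow> measure_pmf.prob out {Accept, Cluster_Reject} \<ge> 5 / 6) \<and>
         (emd d \<mu> \<nu> > \<epsilon> \<longrightarrow> measure_pmf.prob out {Reject, Cluster_Reject} \<ge> 5 / 6)))"

section \<open>The grid\<close>

type_synonym point = "int \<times> int"

definition grid :: "nat \<Rightarrow> point set" where
  "grid n = {1..int n} \<times> {1..int n}"

definition real_point :: "point \<Rightarrow> real \<times> real" where
  "real_point x = (real_of_int (fst x), real_of_int (snd x))"

definition lp_norm :: "real \<Rightarrow> real \<times> real \<Rightarrow> real" where
  "lp_norm p v = (\<bar>fst v\<bar> powr p + \<bar>snd v\<bar> powr p) powr (1 / p)"

definition grid_dist :: "real \<Rightarrow> nat \<Rightarrow> point \<Rightarrow> point \<Rightarrow> real" where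
  "grid_dist p n x y = lp_norm p (real_point x - real_point y) / (2 powr (1 / p) * real n)"

definition grid_adjacent :: "point \<Rightarrow> point \<Rightarrow> bool" where
  "grid_adjacent x y \<longleftrightarrow> \<bar>fst x - fst y\<bar> + \<bar>snd x - snd y\<bar> = 1"

definition grid_connected :: "point set \<Rightarrow> bool" where
  "grid_connected S \<longleftrightarrow>
     (\<forall>x\<in>S. \<forall>y\<in>S. (x, y) \<in> {(a, b). a \<in> S \<and> b \<in> S \<and> grid_adjacent a b}\<^sup>*)"

definition grid_convex :: "nat \<Rightarrow> point set \<Rightarrow> bool" where
  "grid_convex n S \<longleftrightarrow> S = {x \<in> grid n. real_point x \<in> convex hull (real_point ` S)}"

definition grid_box :: "nat \<Rightarrow> point set \<Rightarrow> bool" where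
  "grid_box n S \<longleftrightarrow>
     (\<exists>a1 b1 a2 b2. S = {x \<in> grid n. a1 \<le> fst x \<and> fst x \<le> b1 \<and> a2 \<le> snd x \<and> snd x \<le> b2})"

definition CC :: "nat \<Rightarrow> point clustering set" where
  "CC n = {(\<Gamma>, rep) \<in> clusterings (grid n). \<forall>C\<in>\<Gamma>. grid_connected C \<and> grid_convex n C}"

definition boxes :: "nat \<Rightarrow> point clustering set" where
  "boxes n = {(\<Gamma>, rep) \<in> CC n. \<forall>C\<in>\<Gamma>. grid_box n C}"

end

theory Submission
  imports Defs
begin

text \<open>A sampled cell is probed by four binary searches for the extents of the cross through its representative
  and by 16 further queries. They accept every box of small diameter, and acceptance of any cell of a
  clustering in \<open>CC\<close> forces it to exceed a small box by at most 2. So either one of \<open>O(1/\<epsilon>)\<close> probes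
  exposes a bad cell, or, up to an error below \<open>\<epsilon>\<close>, the unknown distributions may be replaced by their
  clustered versions. Those are compared through the weighted l1 distance of the empirical
  distributions on a hierarchy of dyadic grids, which dominates the earth mover's distance; since the
  number of cells and the weights balance, \<open>(log(1/\<epsilon>)/\<epsilon>)\<^sup>2\<close> samples suffice. All distance estimates go
  through the sup distance, which is within a factor of 2 of each normalized \<open>l\<^sub>p\<close> metric.\<close>

section \<open>Coupling on all scales\<close>

text \<open>Learning both clustered distributions in l1 up to \<open>\<epsilon>\<close> on a grid
  with cells of side \<open>\<epsilon>\<close>, about \<open>1 / \<epsilon>^2\<close> in number,
  would take about \<open>1 / \<epsilon>^4\<close> samples. The earth mover's distance is more
  lenient: a discrepancy that is repaired inside a coarse cell costs only the side of that cell.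
  Exploiting this takes a single coupling that is good on all scales at once. The other obstacle is
  that the clustering itself nearly exhausts the error budget. Moving points to their
  representatives may cost \<open>2 * \<Delta> + 2 / n\<close> per distribution:
  \<open>2 * \<Delta>\<close> is the price of passing to the sup distance, \<open>2 / n\<close> that
  of the excess. Twice this is below \<open>15 / 16 * \<epsilon>\<close>. Undetected bad cells and
  the finest cells take \<open>\<epsilon> / 20 + \<epsilon> / 160\<close>, which leaves
  \<open>\<epsilon> / 160\<close> for the multiscale distance. The number of probes is squeezed from
  both sides: at least \<open>80 / \<epsilon>\<close> to hit bad cells of mass
  \<open>\<epsilon> / 40\<close>, at most \<open>81 / \<epsilon>\<close> so that
  \<open>guard_const\<close> protects the box clusterings.\<close>

definition mix :: "real \<Rightarrow> 'a pmf \<Rightarrow> 'a pmf \<Rightarrow> 'a pmf" where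
  "mix \<delta> r c = bind_pmf (bernoulli_pmf \<delta>) (\<lambda>b. if b then r else c)"

lemma pmf_mix:
  assumes "0 \<le> \<delta>" "\<delta> \<le> 1"
  shows "pmf (mix \<delta> r c) x = \<delta> * pmf r x + (1 - \<delta>) * pmf c x"
  unfolding mix_def pmf_bind
  by (subst integral_measure_pmf[of UNIV]) (auto simp: UNIV_bool assms)

text \<open>This carries the decomposition of \<open>common_part\<close> to every coarser scale, and
  it makes a mixture of couplings a coupling of the mixtures.\<close>

lemma map_mix: "map_pmf f (mix \<delta> r c) = mix \<delta> (map_pmf f r) (map_pmf f c)"
  unfolding mix_def map_bind_pmf by (rule bind_pmf_cong) auto

lemma prob_mix:
  assumes "0 \<le> \<delta>" "\<delta> \<le> 1"
  shows "measure_pmf.prob (mix \<delta> r c) A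
    = \<delta> * measure_pmf.prob r A + (1 - \<delta>) * measure_pmf.prob c A"
proof -
  have "measure_pmf.prob p A = pmf (map_pmf (\<lambda>x. x \<in> A) p) True" for p
    by (simp add: pmf_map vimage_def)
  then show ?thesis
    by (simp add: map_mix pmf_mix assms)
qed

text \<open>Twice the total variation distance. It is meaningful for finite supports only, since a
  sum over an infinite set is 0.\<close>

definition l1_dist :: "'a pmf \<Rightarrow> 'a pmf \<Rightarrow> real" where
  "l1_dist \<mu> \<nu> = (\<Sum>x\<in>set_pmf \<mu> \<union> set_pmf \<nu>. \<bar>pmf \<mu> x - pmf \<nu> x\<bar>)"

lemma l1_dist_eq_sum:
  assumes "finite A" "set_pmf \<mu> \<union> set_pmf \<nu> \<subseteq> A"
  shows "l1_dist \<mu> \<nu> = (\<Sum>x\<in>A. \<bar>pmf \<mu> x - pmf \<nu> x\<bar>)"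
  unfolding l1_dist_def
  by (rule sum.mono_neutral_left) (use assms in \<open>auto simp: set_pmf_iff\<close>)

text \<open>The common part \<open>c\<close> cancels pointwise, so only the residuals
  contribute.\<close>

lemma l1_dist_mix:
  assumes "0 \<le> \<delta>" "\<delta> \<le> 1" "finite (set_pmf r)" "finite (set_pmf s)" "finite (set_pmf c)"
  shows "l1_dist (mix \<delta> r c) (mix \<delta> s c) = \<delta> * l1_dist r s"
proof -
  let ?A = "set_pmf r \<union> set_pmf s \<union> set_pmf c"
  have "set_pmf (mix \<delta> r c) \<union> set_pmf (mix \<delta> s c) \<subseteq> ?A"
    by (auto simp: mix_def split: if_splits)
  then have "l1_dist (mix \<delta> r c) (mix \<delta> s c)
      = (\<Sum>x\<in>?A. \<bar>pmf (mix \<delta> r c) x - pmf (mix \<delta> s c) x\<bar>)"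
    using assms by (intro l1_dist_eq_sum) auto
  also have "\<dots> = (\<Sum>x\<in>?A. \<delta> * \<bar>pmf r x - pmf s x\<bar>)"
  proof (rule sum.cong)
    fix x
    have "pmf (mix \<delta> r c) x - pmf (mix \<delta> s c) x = \<delta> * (pmf r x - pmf s x)"
      by (simp add: pmf_mix assms algebra_simps)
    then show "\<bar>pmf (mix \<delta> r c) x - pmf (mix \<delta> s c) x\<bar> = \<delta> * \<bar>pmf r x - pmf s x\<bar>"
      using assms(1) by (simp add: abs_mult)
  qed simp
  also have "\<dots> = \<delta> * l1_dist r s"
    using assms by (subst l1_dist_eq_sum[of ?A]) (auto simp: sum_distrib_left)
  finally show ?thesis .
qed

lemma finite_support_pmf_exists:
  fixes f :: "'a \<Rightarrow> real"
  assumes "finite A" "\<And>x. 0 \<le> f x" "\<And>x. x \<notin> A \<Longrightarrow> f x = 0" "sum f A = 1"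
  shows "\<exists>p. \<forall>x. pmf p x = f x"
proof -
  have "(\<integral>\<^sup>+x. ennreal (f x) \<partial>count_space UNIV) = (\<Sum>x\<in>A. ennreal (f x))"
    by (rule nn_integral_count_space') (use assms in auto)
  also have "\<dots> = 1"
    using assms by (simp add: sum_ennreal)
  finally have "pmf (embed_pmf f) x = f x" for x
    by (intro pmf_embed_pmf assms)
  then show ?thesis by blast
qed

text \<open>The common part is \<open>min \<mu> \<nu>\<close>; what remains of \<open>\<mu>\<close> and of \<open>\<nu>\<close> has mass equal to half their
  l1 distance.\<close>

lemma common_part:
  fixes \<mu> \<nu> :: "'a pmf"
  assumes fin: "finite (set_pmf \<mu>)" "finite (set_pmf \<nu>)"
  obtains \<delta> r s c where "\<delta> = l1_dist \<mu> \<nu> / 2" "0 \<le> \<delta>" "\<delta> \<le> 1"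
    "\<mu> = mix \<delta> r c" "\<nu> = mix \<delta> s c"
    "finite (set_pmf r)" "finite (set_pmf s)" "finite (set_pmf c)"
proof -
  define A where "A = set_pmf \<mu> \<union> set_pmf \<nu>"
  define \<delta> where "\<delta> = l1_dist \<mu> \<nu> / 2"
  define m where "m x = min (pmf \<mu> x) (pmf \<nu> x)" for x
  have finA: "finite A" using fin by (simp add: A_def)
  have off: "pmf \<mu> x = 0" "pmf \<nu> x = 0" if "x \<notin> A" for x
    using that by (auto simp: A_def set_pmf_iff)
  have sums: "sum (pmf \<mu>) A = 1" "sum (pmf \<nu>) A = 1"
    using finA by (auto intro!: sum_pmf_eq_1 simp: A_def)
  \<comment> \<open>In this form the total mass of \<open>m\<close> can be read off as
    \<open>1 - \<delta>\<close>.\<close>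
  have m: "m x = (pmf \<mu> x + pmf \<nu> x - \<bar>pmf \<mu> x - pmf \<nu> x\<bar>) / 2" for x
    by (auto simp: m_def min_def)
  have summ: "sum m A = 1 - \<delta>"
    unfolding m sum_divide_distrib[symmetric] sum_subtractf sum.distrib sums
    by (simp add: \<delta>_def l1_dist_def A_def[symmetric] diff_divide_distrib)
  have m0: "0 \<le> m x" "m x \<le> pmf \<mu> x" "m x \<le> pmf \<nu> x" for x by (auto simp: m_def)
  have \<delta>: "0 \<le> \<delta>" "\<delta> \<le> 1"
    using sum_nonneg[of A m] m0 summ by (auto simp: \<delta>_def l1_dist_def intro!: sum_nonneg)
  have residual: "\<exists>r. finite (set_pmf r) \<and> (\<forall>x. \<delta> * pmf r x = pmf \<rho> x - m x)"
    if \<rho>: "\<rho> = \<mu> \<or> \<rho> = \<nu>" for \<rho>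
  proof (cases "\<delta> = 0")
    \<comment> \<open>A residual of weight 0 may be any pmf; what has to be seen is that
      \<open>\<rho>\<close> agrees with \<open>m\<close>.\<close>
    case True
    have "(\<Sum>x\<in>A. pmf \<rho> x - m x) = 0"
      using \<rho> sums summ True by (auto simp: sum_subtractf)
    then have "\<forall>x\<in>A. pmf \<rho> x - m x = 0"
      using m0 \<rho> finA by (subst (asm) sum_nonneg_eq_0_iff) auto
    then have "pmf \<rho> x - m x = 0" for x using off[of x] \<rho> by (cases "x \<in> A") (auto simp: m_def)
    then show ?thesis using True fin by (intro exI[of _ \<mu>]) auto
  next
    case False
    have "\<exists>r. \<forall>x. pmf r x = (pmf \<rho> x - m x) / \<delta>"
    proof (rule finite_support_pmf_exists[OF finA])
      show "0 \<le> (pmf \<rho> x - m x) / \<delta>" for x using m0 \<delta> \<rho> by auto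
      show "(pmf \<rho> x - m x) / \<delta> = 0" if "x \<notin> A" for x using off[OF that] \<rho> by (auto simp: m_def)
      show "(\<Sum>x\<in>A. (pmf \<rho> x - m x) / \<delta>) = 1"
        using \<rho> sums summ False by (auto simp: sum_divide_distrib[symmetric] sum_subtractf)
    qed
    then obtain r where r: "\<And>x. pmf r x = (pmf \<rho> x - m x) / \<delta>" by auto
    have "pmf r x = 0" if "x \<notin> A" for x using off[OF that] \<rho> by (auto simp: r m_def)
    then have "set_pmf r \<subseteq> A" by (meson set_pmf_iff subsetI)
    then show ?thesis using r False finA by (intro exI[of _ r]) (auto intro: finite_subset)
  qed
  have "\<exists>c. finite (set_pmf c) \<and> (\<forall>x. (1 - \<delta>) * pmf c x = m x)"
  proof (cases "\<delta> = 1")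
    case True
    then have "\<forall>x\<in>A. m x = 0"
      using summ m0 finA by (simp add: sum_nonneg_eq_0_iff)
    then have "m x = 0" for x using off[of x] by (cases "x \<in> A") (auto simp: m_def)
    then show ?thesis using True fin by auto
  next
    case False
    have "\<exists>c. \<forall>x. pmf c x = m x / (1 - \<delta>)"
    proof (rule finite_support_pmf_exists[OF finA])
      show "0 \<le> m x / (1 - \<delta>)" for x using m0 \<delta> by auto
      show "m x / (1 - \<delta>) = 0" if "x \<notin> A" for x using off[OF that] by (auto simp: m_def)
      show "(\<Sum>x\<in>A. m x / (1 - \<delta>)) = 1"
        using summ False by (auto simp: sum_divide_distrib[symmetric])
    qed
    then obtain c where c: "\<And>x. pmf c x = m x / (1 - \<delta>)" by auto
    have "pmf c x = 0" if "x \<notin> A" for x using off[OF that] by (auto simp: c m_def)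
    then have "set_pmf c \<subseteq> A" by (meson set_pmf_iff subsetI)
    then show ?thesis using c False finA by (intro exI[of _ c]) (auto intro: finite_subset)
  qed
  then obtain c where c: "finite (set_pmf c)" "\<And>x. (1 - \<delta>) * pmf c x = m x" by auto
  obtain r where r: "finite (set_pmf r)" "\<And>x. \<delta> * pmf r x = pmf \<mu> x - m x"
    using residual[of \<mu>] by auto
  obtain s where s: "finite (set_pmf s)" "\<And>x. \<delta> * pmf s x = pmf \<nu> x - m x"
    using residual[of \<nu>] by auto
  have "\<mu> = mix \<delta> r c" "\<nu> = mix \<delta> s c"
    by (rule pmf_eqI; simp add: pmf_mix \<delta> c r s)+
  with \<delta>_def \<delta> show ?thesis
    using r(1) s(1) c(1) by (rule that)
qed

section \<open>Lifting couplings along a map\<close>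

lemma pair_pmf_in_couplings: "pair_pmf \<mu> \<nu> \<in> couplings \<mu> \<nu>"
  by (simp add: couplings_def map_fst_pair_pmf map_snd_pair_pmf)

lemma bind_cond_pmf_fibres: "bind_pmf (map_pmf f \<mu>) (\<lambda>a. cond_pmf \<mu> {x. f x = a}) = \<mu>"
proof -
  have "bind_pmf \<mu> (\<lambda>z. cond_pmf \<mu> {x. f z = f x}) = \<mu>"
    by (rule bind_cond_pmf_cancel) (auto simp: eq_commute)
  then show ?thesis by (simp add: bind_map_pmf eq_commute)
qed

text \<open>Draw a pair of images from \<open>\<pi>\<close>, then resample the two coordinates
  independently within the fibres of \<open>\<mu>\<close> and \<open>\<nu>\<close> above them. By
  \<open>bind_cond_pmf_fibres\<close> this restores both marginals.\<close>

lemma coupling_lift: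
  assumes "\<pi> \<in> couplings (map_pmf f \<mu>) (map_pmf f \<nu>)"
  shows "\<exists>\<rho>\<in>couplings \<mu> \<nu>. map_pmf (map_prod f f) \<rho> = \<pi>"
proof -
  have fst: "map_pmf fst \<pi> = map_pmf f \<mu>" and snd: "map_pmf snd \<pi> = map_pmf f \<nu>"
    using assms by (auto simp: couplings_def)
  define fib where "fib \<kappa> a = cond_pmf \<kappa> {x. f x = a}" for \<kappa> a
  define \<rho> where "\<rho> = bind_pmf \<pi> (\<lambda>z. pair_pmf (fib \<mu> (fst z)) (fib \<nu> (snd z)))"
  have "map_pmf fst \<rho> = bind_pmf (map_pmf fst \<pi>) (fib \<mu>)"
    by (simp add: \<rho>_def map_bind_pmf map_fst_pair_pmf bind_map_pmf)
  then have 1: "map_pmf fst \<rho> = \<mu>" by (simp add: fst fib_def[abs_def] bind_cond_pmf_fibres)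
  have "map_pmf snd \<rho> = bind_pmf (map_pmf snd \<pi>) (fib \<nu>)"
    by (simp add: \<rho>_def map_bind_pmf map_snd_pair_pmf bind_map_pmf)
  then have 2: "map_pmf snd \<rho> = \<nu>" by (simp add: snd fib_def[abs_def] bind_cond_pmf_fibres)
  \<comment> \<open>Conditioning requires a fibre of positive mass. Both coordinates of a pair in
    the support of \<open>\<pi>\<close> have one, by the marginals of \<open>\<pi>\<close>.\<close>
  have fib: "map_pmf f (fib \<kappa> a) = return_pmf a" if "a \<in> f ` set_pmf \<kappa>" for \<kappa> a
  proof -
    have "set_pmf (fib \<kappa> a) \<subseteq> {x. f x = a}"
      unfolding fib_def using that by (subst set_cond_pmf) auto
    then have "map_pmf f (fib \<kappa> a) = map_pmf (\<lambda>_. a) (fib \<kappa> a)"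
      by (intro map_pmf_cong) auto
    then show ?thesis by simp
  qed
  have "map_pmf (map_prod f f) \<rho>
      = bind_pmf \<pi> (\<lambda>z. pair_pmf (map_pmf f (fib \<mu> (fst z))) (map_pmf f (fib \<nu> (snd z))))"
    by (simp add: \<rho>_def map_bind_pmf map_pair map_prod_def)
  also have "\<dots> = bind_pmf \<pi> return_pmf"
  proof (rule bind_pmf_cong[OF refl])
    fix z assume z: "z \<in> set_pmf \<pi>"
    have "fst z \<in> f ` set_pmf \<mu>" using z arg_cong[OF fst, of set_pmf] by auto
    moreover have "snd z \<in> f ` set_pmf \<nu>" using z arg_cong[OF snd, of set_pmf] by auto
    ultimately show "pair_pmf (map_pmf f (fib \<mu> (fst z))) (map_pmf f (fib \<nu> (snd z))) = return_pmf z"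
      by (simp add: fib pair_return_pmf1)
  qed
  finally have "map_pmf (map_prod f f) \<rho> = \<pi>" by (simp add: bind_return_pmf')
  with 1 2 show ?thesis by (auto simp: couplings_def)
qed

lemma map_pmf_funpow_Suc:
  fixes h :: "'a \<Rightarrow> 'a"
  shows "map_pmf (h ^^ Suc i) \<mu> = map_pmf (h ^^ i) (map_pmf h \<mu>)"
  by (simp only: funpow_Suc_right map_pmf_compose comp_apply)

text \<open>The common part of the two pmfs is coupled on the diagonal, at no cost on any scale. The
  residuals have a difference proportional to that of the pmfs, on every coarser scale as well, so
  that coupling them recursively from the next scale on gives the optimum on all scales at once.\<close>

lemma multiscale_coupling:
  fixes \<mu> \<nu> :: "'a pmf" and h :: "'a \<Rightarrow> 'a"
  assumes "finite (set_pmf \<mu>)" "finite (set_pmf \<nu>)"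
  shows "\<exists>\<pi>\<in>couplings \<mu> \<nu>. \<forall>i<k. measure_pmf.prob \<pi> {(x, y). (h ^^ i) x \<noteq> (h ^^ i) y}
    \<le> l1_dist (map_pmf (h ^^ i) \<mu>) (map_pmf (h ^^ i) \<nu>) / 2"
  using assms
proof (induction k arbitrary: \<mu> \<nu>)
  case 0
  then show ?case using pair_pmf_in_couplings by auto
next
  case (Suc k)
  obtain \<delta> r s c where \<delta>_eq: "\<delta> = l1_dist \<mu> \<nu> / 2" and \<delta>: "0 \<le> \<delta>" "\<delta> \<le> 1"
    and mix: "\<mu> = mix \<delta> r c" "\<nu> = mix \<delta> s c"
    and fin: "finite (set_pmf r)" "finite (set_pmf s)" "finite (set_pmf c)"
    by (rule common_part[OF Suc.prems])
  obtain \<pi>' where \<pi>': "\<pi>' \<in> couplings (map_pmf h r) (map_pmf h s)"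
    "\<And>i. i < k \<Longrightarrow> measure_pmf.prob \<pi>' {(x, y). (h ^^ i) x \<noteq> (h ^^ i) y}
      \<le> l1_dist (map_pmf (h ^^ i) (map_pmf h r)) (map_pmf (h ^^ i) (map_pmf h s)) / 2"
    using Suc.IH[of "map_pmf h r" "map_pmf h s"] fin by auto
  obtain \<rho> where \<rho>: "\<rho> \<in> couplings r s" "map_pmf (map_prod h h) \<rho> = \<pi>'"
    using coupling_lift[OF \<pi>'(1)] by blast
  define \<pi> where "\<pi> = mix \<delta> \<rho> (map_pmf (\<lambda>x. (x, x)) c)"
  have "\<pi> \<in> couplings \<mu> \<nu>"
    using \<rho>(1) unfolding mix(1,2) by (simp add: \<pi>_def couplings_def map_mix map_pmf_comp)
  moreover have "measure_pmf.prob \<pi> {(x, y). (h ^^ i) x \<noteq> (h ^^ i) y}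
    \<le> l1_dist (map_pmf (h ^^ i) \<mu>) (map_pmf (h ^^ i) \<nu>) / 2" if "i < Suc k" for i
  proof -
    have eq: "measure_pmf.prob \<pi> {(x, y). (h ^^ i) x \<noteq> (h ^^ i) y}
        = \<delta> * measure_pmf.prob \<rho> {(x, y). (h ^^ i) x \<noteq> (h ^^ i) y}"
      by (simp add: \<pi>_def prob_mix \<delta> vimage_def)
    show ?thesis
    proof (cases i)
      case 0
      \<comment> \<open>On the finest scale the residuals may be separated completely; the bound is
        their weight \<open>\<delta>\<close>, which is half the l1 distance.\<close>
      show ?thesis
        unfolding eq using 0 \<delta> by (simp add: \<delta>_eq[symmetric] mult_left_le map_pmf_ident)
    next
      case (Suc j)
      have "measure_pmf.prob \<rho> {(x, y). (h ^^ i) x \<noteq> (h ^^ i) y}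
          = measure_pmf.prob \<pi>' {(x, y). (h ^^ j) x \<noteq> (h ^^ j) y}"
        unfolding \<rho>(2)[symmetric] by (simp add: Suc vimage_def funpow_swap1 case_prod_unfold)
      also have "\<dots> \<le> l1_dist (map_pmf (h ^^ i) r) (map_pmf (h ^^ i) s) / 2"
        unfolding Suc map_pmf_funpow_Suc using that Suc by (intro \<pi>'(2)) auto
      finally have "\<delta> * measure_pmf.prob \<rho> {(x, y). (h ^^ i) x \<noteq> (h ^^ i) y}
          \<le> \<delta> * (l1_dist (map_pmf (h ^^ i) r) (map_pmf (h ^^ i) s) / 2)"
        using \<delta> by (intro mult_left_mono)
      then show ?thesis
        unfolding eq mix(1,2) map_mix using fin \<delta> by (simp add: l1_dist_mix)
    qed
  qed
  ultimately show ?case by blast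
qed

section \<open>Geometry of cells\<close>

definition sup_dist :: "nat \<Rightarrow> point \<Rightarrow> point \<Rightarrow> real" where
  "sup_dist n x y = real_of_int (max \<bar>fst x - fst y\<bar> \<bar>snd x - snd y\<bar>) / real n"

lemma sup_dist_triangle: "sup_dist n x z \<le> sup_dist n x y + sup_dist n y z"
proof -
  let ?m = "\<lambda>x y :: point. max \<bar>fst x - fst y\<bar> \<bar>snd x - snd y\<bar>"
  have "?m x z \<le> ?m x y + ?m y z" by auto
  then have "real_of_int (?m x z) \<le> real_of_int (?m x y) + real_of_int (?m y z)" by linarith
  then show ?thesis
    unfolding sup_dist_def by (metis add_divide_distrib divide_right_mono of_nat_0_le_iff)
qed

lemma sup_dist_commute: "sup_dist n x y = sup_dist n y x"
  by (simp add: sup_dist_def abs_minus_commute)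

lemma sup_dist_le_1:
  assumes "x \<in> grid n" "y \<in> grid n"
  shows "sup_dist n x y \<le> 1"
proof -
  have "max \<bar>fst x - fst y\<bar> \<bar>snd x - snd y\<bar> \<le> int n"
    using assms by (auto simp: grid_def)
  then have "real_of_int (max \<bar>fst x - fst y\<bar> \<bar>snd x - snd y\<bar>) \<le> real n" by linarith
  then show ?thesis
    unfolding sup_dist_def by (auto simp: divide_le_eq_1)
qed

text \<open>The unnormalized norm lies between the maximum \<open>M\<close> and
  \<open>2 powr (1 / p) * M\<close>. Dividing by \<open>2 powr (1 / p)\<close>, which is at most 2,
  makes the upper bound exact and costs a factor of at most 2 in the lower one.\<close>

lemma grid_dist_bounds:
  assumes "1 \<le> p" "1 \<le> n"
  shows "0 \<le> grid_dist p n x y" "grid_dist p n x y \<le> sup_dist n x y"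
    "sup_dist n x y \<le> 2 * grid_dist p n x y"
proof -
  define a b where "a = \<bar>real_of_int (fst x - fst y)\<bar>" and "b = \<bar>real_of_int (snd x - snd y)\<bar>"
  define M where "M = max a b"
  define s where "s = a powr p + b powr p"
  have nonneg: "0 \<le> a" "0 \<le> b" "0 \<le> M" by (auto simp: a_def b_def M_def)
  have le: "a powr p \<le> M powr p" "b powr p \<le> M powr p"
    using nonneg assms by (auto intro!: powr_mono2 simp: M_def)
  have M: "(M powr p) powr (1 / p) = M"
    using nonneg assms by (simp add: powr_powr)
  have "M powr p \<le> s" by (auto simp: M_def s_def max_def)
  then have "(M powr p) powr (1 / p) \<le> s powr (1 / p)"
    using assms by (intro powr_mono2) auto
  then have lower: "M \<le> s powr (1 / p)" by (simp only: M)
  have "s powr (1 / p) \<le> (2 * M powr p) powr (1 / p)"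
    using assms le by (intro powr_mono2) (auto simp: s_def)
  also have "\<dots> = 2 powr (1 / p) * M" using M by (simp add: powr_mult)
  finally have upper: "s powr (1 / p) \<le> 2 powr (1 / p) * M" .
  have two: "2 powr (1 / p) \<le> (2 :: real)"
    using assms powr_mono[of "1 / p" 1 "2 :: real"] by simp
  have sup: "sup_dist n x y = M / real n"
    by (simp add: sup_dist_def M_def a_def b_def of_int_max)
  have dist: "grid_dist p n x y = s powr (1 / p) / (2 powr (1 / p) * real n)"
    by (simp add: grid_dist_def lp_norm_def real_point_def s_def a_def b_def)
  show "0 \<le> grid_dist p n x y" by (simp add: dist)
  show "grid_dist p n x y \<le> sup_dist n x y"
    using upper assms by (simp add: dist sup field_simps)
  have "M * 2 powr (1 / p) \<le> s powr (1 / p) * 2"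
    using lower two nonneg by (intro mult_mono) auto
  then show "sup_dist n x y \<le> 2 * grid_dist p n x y"
    using assms by (simp add: dist sup field_simps)
qed

lemma finite_grid: "finite (grid n)"
  by (simp add: grid_def)

lemma dist_le_diam:
  assumes "finite S" "x \<in> S" "y \<in> S"
  shows "d x y \<le> diam d S"
proof -
  have "finite ((\<lambda>(x, y). d x y) ` (S \<times> S))" using assms by simp
  then have "bdd_above ((\<lambda>(x, y). d x y) ` (S \<times> S))" by (rule bdd_above_finite)
  then show ?thesis
    unfolding diam_def using cSUP_upper[of "(x, y)" "S \<times> S" "\<lambda>(x, y). d x y"] assms by simp
qed

section \<open>Sections of convex sets of lattice points\<close>

lemma convex_column:
  fixes H :: "(real \<times> real) set"
  assumes "convex H" "(x, a) \<in> H" "(x, b) \<in> H" "a \<le> z" "z \<le> b"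
  shows "(x, z) \<in> H"
proof -
  have "z \<in> closed_segment a b"
    using assms by (simp add: closed_segment_eq_real_ivl)
  then obtain t where t: "0 \<le> t" "t \<le> 1" "z = (1 - t) * a + t * b"
    by (auto simp: closed_segment_def)
  have "(1 - t) *\<^sub>R (x, a) + t *\<^sub>R (x, b) \<in> H"
    using assms t by (intro convexD) auto
  also have "(1 - t) *\<^sub>R (x, a) + t *\<^sub>R (x, b) = (x, z)"
    by (simp add: t algebra_simps)
  finally show ?thesis .
qed

text \<open>The section of the triangle at distance 1 from its base has at least 2/3 of the length of the
  base, which leaves no room to avoid all three lattice points.\<close>

lemma convex_triangle_section:
  fixes H :: "(real \<times> real) set"
    and a \<sigma> N l u y :: int
  assumes H: "convex H"
    and base: "(of_int a, of_int l) \<in> H" "(of_int a, of_int u) \<in> H"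
    and apex: "(of_int (a + \<sigma> * N), of_int y) \<in> H"
    and y: "l \<le> y" "y \<le> u" and N: "3 \<le> N"
  shows "\<exists>c\<in>{l, (l + u) div 2, u}. (of_int (a + \<sigma>), of_int c) \<in> H"
proof -
  \<comment> \<open>The line from the apex through \<open>(a + \<sigma>, c)\<close> meets the line
    of the base at height \<open>(N * c - y) / (N - 1)\<close>. The two inequalities put this height
    between \<open>l\<close> and \<open>u\<close>.\<close>
  obtain c where c: "c \<in> {l, (l + u) div 2, u}" "(N - 1) * l \<le> N * c - y" "N * c - y \<le> (N - 1) * u"
  proof (cases "u - l \<le> 1")
    case True
    have "(N - 1) * l \<le> (N - 1) * y" "(N - 1) * y \<le> (N - 1) * u"
      using y N by (auto intro!: mult_left_mono)
    then show ?thesis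
      using True y by (intro that[of y]) (auto simp: algebra_simps)
  next
    case False
    define c where "c = (l + u) div 2"
    have two_c: "l + u - 1 \<le> 2 * c" "2 * c \<le> l + u" by (auto simp: c_def)
    have "0 \<le> (N - 2) * (u - l)" using False N by simp
    moreover have "N * (2 * c) \<le> N * (l + u)" using two_c N by simp
    ultimately have upper: "N * c - y \<le> (N - 1) * u"
      using y by (simp add: algebra_simps)
    have lower: "(N - 1) * l \<le> N * c - y"
    \<comment> \<open>Rounding the midpoint down costs at most \<open>N\<close> in the doubled
      inequality, while the width gains \<open>(N - 2) * (u - l)\<close>. This suffices from width 3
      on, since \<open>N\<close> is at least 3. At width 2 it can fail, but there the midpoint is
      exact.\<close>
    proof (cases "u - l = 2")
      case True
      then have "c = l + 1" by (auto simp: c_def)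
      then show ?thesis using True y N by (simp add: algebra_simps)
    next
      case wide: False
      have "(N - 2) * 3 \<le> (N - 2) * (u - l)"
        using False wide N by (intro mult_left_mono) auto
      moreover have "N * (l + u - 1) \<le> N * (2 * c)" using two_c N by simp
      ultimately show ?thesis using y N by (simp add: algebra_simps)
    qed
    show ?thesis using upper lower by (intro that[of c]) (auto simp: c_def)
  qed
  define z where "z = real_of_int (N * c - y) / real_of_int (N - 1)"
  have "(of_int a, z) \<in> H"
  proof (rule convex_column[OF H base])
    have "real_of_int ((N - 1) * l) \<le> real_of_int (N * c - y)"
      using c by linarith
    then show "of_int l \<le> z" using N by (simp add: z_def field_simps)
    have "real_of_int (N * c - y) \<le> real_of_int ((N - 1) * u)"
      using c by linarith
    then show "z \<le> of_int u" using N by (simp add: z_def field_simps)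
  qed
  then have "(1 - 1 / of_int N) *\<^sub>R (of_int a :: real, z)
      + (1 / of_int N) *\<^sub>R (of_int (a + \<sigma> * N), of_int y) \<in> H"
    using N by (intro convexD[OF H _ apex]) auto
  also have "(1 - 1 / of_int N) *\<^sub>R (of_int a :: real, z)
        + (1 / of_int N) *\<^sub>R (of_int (a + \<sigma> * N), of_int y)
      = (of_int (a + \<sigma>), of_int c :: real)"
  proof -
    have "(1 - 1 / of_int N) * z = (of_int N * of_int c - of_int y) / of_int N"
      using N by (simp add: z_def field_simps)
    then have "(1 - 1 / of_int N) * z + of_int y / of_int N = of_int c"
      using N by (simp add: diff_divide_distrib)
    then show ?thesis using N by (simp add: field_simps)
  qed
  finally show ?thesis using c by blast
qed

lemma grid_convexD: "grid_convex n S \<Longrightarrow> x \<in> grid n \<Longrightarrow> real_point x \<in> convex hull (real_point ` S) \<Longrightarrow> x \<in> S"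
  unfolding grid_convex_def by blast

lemma grid_convex_subset: "grid_convex n S \<Longrightarrow> S \<subseteq> grid n"
  unfolding grid_convex_def by blast

lemma in_real_hull: "(x, y) \<in> S \<Longrightarrow> (of_int x, of_int y) \<in> convex hull (real_point ` S)"
  by (rule hull_inc) (force simp: real_point_def)

lemma grid_convex_column:
  assumes "grid_convex n S" "(x, a) \<in> S" "(x, b) \<in> S" "a \<le> z" "z \<le> b"
  shows "(x, z) \<in> S"
proof (rule grid_convexD[OF assms(1)])
  show "(x, z) \<in> grid n"
    using assms grid_convex_subset[OF assms(1)] by (auto simp: grid_def)
  show "real_point (x, z) \<in> convex hull (real_point ` S)"
    using convex_column[OF convex_convex_hull in_real_hull[OF assms(2)] in_real_hull[OF assms(3)]] assms(4,5)
    by (simp add: real_point_def)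
qed

lemma grid_convex_section:
  assumes S: "grid_convex n S" "(a, l) \<in> S" "(a, u) \<in> S" "(a + \<sigma> * N, y) \<in> S"
    and "l \<le> y" "y \<le> u" "3 \<le> N" "\<bar>\<sigma>\<bar> = 1"
  shows "\<exists>c\<in>{l, (l + u) div 2, u}. (a + \<sigma>, c) \<in> S"
proof -
  obtain c where c: "c \<in> {l, (l + u) div 2, u}"
    "(of_int (a + \<sigma>), of_int c) \<in> convex hull (real_point ` S)"
    using convex_triangle_section[OF convex_convex_hull in_real_hull[OF S(2)] in_real_hull[OF S(3)]
      in_real_hull[OF S(4)]] assms(5-7) by blast
  have "\<sigma> = 1 \<or> \<sigma> = - 1" using assms(8) by auto
  moreover have "l \<le> c" "c \<le> u" using c(1) assms(5,6) by auto
  \<comment> \<open>\<open>grid_convex\<close> recovers from the hull only the points of the grid.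
    This one lies in it because its coordinates are between those of points of
    \<open>S\<close>.\<close>
  ultimately have "(a + \<sigma>, c) \<in> grid n"
    using S(2-4) assms(7) grid_convex_subset[OF S(1)] by (auto simp: grid_def)
  then show ?thesis
    using c grid_convexD[OF S(1)] by (auto simp: real_point_def)
qed

text \<open>Reflection is linear and commutes with the convex hull, so every statement about columns
  also yields the one about rows.\<close>

lemma grid_convex_swap:
  assumes "grid_convex n S"
  shows "grid_convex n (prod.swap ` S)"
proof -
  have lin: "linear (prod.swap :: real \<times> real \<Rightarrow> real \<times> real)"
    by (rule linearI) auto
  have "real_point ` prod.swap ` S = prod.swap ` real_point ` S"
    by (auto simp: real_point_def image_image)
  then have hull: "convex hull (real_point ` prod.swap ` S) = prod.swap ` (convex hull (real_point ` S))"
    by (simp add: convex_hull_linear_image[OF lin])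
  have swap_real: "real_point x \<in> prod.swap ` H \<longleftrightarrow> real_point (prod.swap x) \<in> H" for x H
    by (cases x) (force simp: real_point_def)
  have swap_in: "x \<in> prod.swap ` S \<longleftrightarrow> prod.swap x \<in> S" for x
    by (cases x) force
  have swap_grid: "x \<in> grid n \<longleftrightarrow> prod.swap x \<in> grid n" for x
    by (cases x) (auto simp: grid_def)
  have mem: "x \<in> S \<longleftrightarrow> x \<in> grid n \<and> real_point x \<in> convex hull (real_point ` S)" for x
    using assms unfolding grid_convex_def by blast
  show ?thesis
    unfolding grid_convex_def hull
  proof (rule set_eqI)
    fix x
    show "x \<in> prod.swap ` S \<longleftrightarrow>
        x \<in> {x \<in> grid n. real_point x \<in> prod.swap ` (convex hull (real_point ` S))}"
      unfolding swap_in mem_Collect_eq swap_real swap_grid[of x] by (rule mem)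
  qed
qed


definition corners :: "int \<Rightarrow> int \<Rightarrow> int \<Rightarrow> int \<Rightarrow> point list" where
  "corners a b a' b' = [(a, a'), (a, b'), (b, a'), (b, b')]"

text \<open>Just outside each side, the three points that \<open>grid_convex_section\<close> offers
  when the side is the base of the triangle.\<close>

definition rim :: "int \<Rightarrow> int \<Rightarrow> int \<Rightarrow> int \<Rightarrow> point list" where
  "rim a b a' b' = (let c = (a + b) div 2; c' = (a' + b') div 2 in
     [(a - 1, a'), (a - 1, c'), (a - 1, b'), (b + 1, a'), (b + 1, c'), (b + 1, b'),
      (a, a' - 1), (c, a' - 1), (b, a' - 1), (a, b' + 1), (c, b' + 1), (b, b' + 1)])"

text \<open>Connectivity confines \<open>S\<close> to the union of the two strips spanned by the box, since a path
  that leaves it has to cross a line through a side outside of that side. Within the strips,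
  \<open>grid_convex_section\<close> limits the excess to 2.\<close>

lemma box_excess:
  assumes conn: "grid_connected S" and conv: "grid_convex n S"
    and corners: "set (corners a b a' b') \<subseteq> S" and rim: "set (rim a b a' b') \<inter> S = {}"
    and r: "r \<in> S" "fst r \<in> {a..b}" "snd r \<in> {a'..b'}" and x: "x \<in> S"
  shows "fst x \<in> {a - 2..b + 2} \<and> snd x \<in> {a' - 2..b' + 2}"
proof -
  have in_S: "(a, a') \<in> S" "(a, b') \<in> S" "(b, a') \<in> S" "(b, b') \<in> S"
    using corners by (auto simp: corners_def)
  have out_S: "(a - 1, a') \<notin> S" "(a - 1, (a' + b') div 2) \<notin> S" "(a - 1, b') \<notin> S"
    "(b + 1, a') \<notin> S" "(b + 1, (a' + b') div 2) \<notin> S" "(b + 1, b') \<notin> S"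
    "(a, a' - 1) \<notin> S" "((a + b) div 2, a' - 1) \<notin> S" "(b, a' - 1) \<notin> S"
    "(a, b' + 1) \<notin> S" "((a + b) div 2, b' + 1) \<notin> S" "(b, b' + 1) \<notin> S"
    using rim by (auto simp: rim_def Let_def)
  note swap = grid_convex_swap[OF conv]
  have col: "(u, w) \<in> S" if "(u, v) \<in> S" "(u, v') \<in> S" "v \<le> w" "w \<le> v'" for u v v' w
    using grid_convex_column[OF conv] that by blast
  have row: "(w, u) \<in> S" if "(v, u) \<in> S" "(v', u) \<in> S" "v \<le> w" "w \<le> v'" for u v v' w
    using grid_convex_column[OF swap, of u v v' w] that by force
  \<comment> \<open>A point of \<open>S\<close> beyond the corner would, by convexity of the column,
    pull the adjacent rim point into \<open>S\<close>.\<close>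
  have side_col: "y \<in> {a'..b'}" if "(u, y) \<in> S" "u \<in> {a, b}" for u y
  proof (rule ccontr)
    assume "y \<notin> {a'..b'}"
    then have "y \<le> a' - 1 \<or> b' + 1 \<le> y" by auto
    then show False
      using that in_S out_S col[of u y a' "a' - 1"] col[of u b' y "b' + 1"] by auto
  qed
  have side_row: "y \<in> {a..b}" if "(y, u) \<in> S" "u \<in> {a', b'}" for u y
  proof (rule ccontr)
    assume "y \<notin> {a..b}"
    then have "y \<le> a - 1 \<or> b + 1 \<le> y" by auto
    then show False
      using that in_S out_S row[of y u a "a - 1"] row[of b u y "b + 1"] by auto
  qed
  let ?strips = "\<lambda>z :: point. fst z \<in> {a..b} \<or> snd z \<in> {a'..b'}"
  have strips: "?strips x"
  proof -
    have "(r, x) \<in> {(a, b). a \<in> S \<and> b \<in> S \<and> grid_adjacent a b}\<^sup>*"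
      using conn r x unfolding grid_connected_def by blast
    then show ?thesis
    proof (induction rule: rtrancl_induct)
      case base
      then show ?case using r by blast
    next
      case (step y z)
      obtain y1 y2 z1 z2 where yz: "y = (y1, y2)" "z = (z1, z2)" by (metis surj_pair)
      have adj: "\<bar>y1 - z1\<bar> + \<bar>y2 - z2\<bar> = 1" and S: "(y1, y2) \<in> S"
        using step.hyps by (auto simp: yz grid_adjacent_def)
      have s1: "y1 = a \<or> y1 = b \<longrightarrow> a' \<le> y2 \<and> y2 \<le> b'"
        and s2: "y2 = a' \<or> y2 = b' \<longrightarrow> a \<le> y1 \<and> y1 \<le> b"
        using side_col[of y1 y2] side_row[of y1 y2] S by auto
      have "a \<le> y1 \<and> y1 \<le> b \<or> a' \<le> y2 \<and> y2 \<le> b'" using step.IH by (simp add: yz)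
      \<comment> \<open>A grid step changes one coordinate by 1. To leave both strips, it would have
        to start on the line of a side with the other coordinate out of range, which
        \<open>s1\<close> and \<open>s2\<close> exclude.\<close>
      then show ?case unfolding yz fst_conv snd_conv atLeastAtMost_iff using adj s1 s2 by smt
    qed
  qed
  \<comment> \<open>\<open>\<sigma>\<close> is the outward direction and
    \<open>\<sigma> * (z - e)\<close> the distance from the side. At distance 3 or more, one of the
    three rim points of that side would belong to \<open>T\<close>.\<close>
  have no_apex: False if "grid_convex n T" "(e, l) \<in> T" "(e, u) \<in> T" "l \<le> y" "y \<le> u"
    "(e + \<sigma>, l) \<notin> T" "(e + \<sigma>, (l + u) div 2) \<notin> T" "(e + \<sigma>, u) \<notin> T"
    "(z, y) \<in> T" "3 \<le> \<sigma> * (z - e)" "\<bar>\<sigma>\<bar> = 1" for T e l u y z \<sigma>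
  proof -
    have "\<sigma> = 1 \<or> \<sigma> = - 1" using that(11) by auto
    then have "e + \<sigma> * (\<sigma> * (z - e)) = z" by auto
    then show False
      using grid_convex_section[OF that(1-3), of \<sigma> "\<sigma> * (z - e)" y] that(4-11) by auto
  qed
  obtain x1 x2 where x12: "x = (x1, x2)" by fastforce
  have swap_in: "(v, u) \<in> prod.swap ` S \<longleftrightarrow> (u, v) \<in> S" for u v by force
  have "x1 \<in> {a - 2..b + 2}" if "x2 \<in> {a'..b'}"
    using no_apex[OF conv, of a a' b' x2 "-1" x1] no_apex[OF conv, of b a' b' x2 1 x1]
      in_S out_S x that x12 by force
  moreover have "x2 \<in> {a' - 2..b' + 2}" if "x1 \<in> {a..b}"
    using no_apex[OF swap, of a' a b x1 "-1" x2] no_apex[OF swap, of b' a b x1 1 x2]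
      in_S out_S x that x12 by (force simp: swap_in)
  ultimately show ?thesis using strips by (auto simp: x12)
qed

section \<open>Multiscale distance and empirical distributions\<close>

lemma l1_dist_triangle:
  assumes "finite (set_pmf \<mu>)" "finite (set_pmf \<nu>)" "finite (set_pmf \<rho>)"
  shows "l1_dist \<mu> \<rho> \<le> l1_dist \<mu> \<nu> + l1_dist \<nu> \<rho>"
proof -
  let ?A = "set_pmf \<mu> \<union> set_pmf \<nu> \<union> set_pmf \<rho>"
  have "finite ?A" using assms by simp
  then have "l1_dist \<mu> \<rho> = (\<Sum>x\<in>?A. \<bar>pmf \<mu> x - pmf \<rho> x\<bar>)"
    "l1_dist \<mu> \<nu> = (\<Sum>x\<in>?A. \<bar>pmf \<mu> x - pmf \<nu> x\<bar>)"
    "l1_dist \<nu> \<rho> = (\<Sum>x\<in>?A. \<bar>pmf \<nu> x - pmf \<rho> x\<bar>)"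
    by (intro l1_dist_eq_sum; auto)+
  then show ?thesis
    by (auto simp: sum.distrib[symmetric] intro!: sum_mono)
qed

lemma l1_dist_commute: "l1_dist \<mu> \<nu> = l1_dist \<nu> \<mu>"
  by (simp add: l1_dist_def Un_commute abs_minus_commute)

lemma l1_dist_nonneg: "0 \<le> l1_dist \<mu> \<nu>"
  by (simp add: l1_dist_def sum_nonneg)

section \<open>Expected deviation of empirical distributions\<close>

text \<open>A uniform index, rather than a uniform element of the set, makes repetitions count. For
  \<open>[]\<close> nothing useful is specified, which is why nonempty lists are assumed
  below.\<close>

definition empirical :: "'a list \<Rightarrow> 'a pmf" where
  "empirical xs = map_pmf ((!) xs) (pmf_of_set {..<length xs})"

lemma set_pmf_empirical: "xs \<noteq> [] \<Longrightarrow> set_pmf (empirical xs) = set xs"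
  by (force simp: empirical_def set_pmf_of_set lessThan_empty_iff in_set_conv_nth)

lemma pmf_map_empirical:
  assumes "xs \<noteq> []"
  shows "pmf (map_pmf f (empirical xs)) c = (\<Sum>x\<leftarrow>xs. of_bool (f x = c)) / real (length xs)"
proof -
  have "pmf (map_pmf f (empirical xs)) c
      = measure_pmf.prob (pmf_of_set {..<length xs}) {i. f (xs ! i) = c}"
    by (simp add: empirical_def map_pmf_comp pmf_map vimage_def)
  also have "\<dots> = card ({..<length xs} \<inter> {i. f (xs ! i) = c}) / real (length xs)"
    using assms by (subst measure_pmf_of_set) (auto simp: lessThan_empty_iff)
  also have "real (card ({..<length xs} \<inter> {i. f (xs ! i) = c})) = (\<Sum>x\<leftarrow>xs. of_bool (f x = c))"
    by (simp add: sum_list_sum_nth atLeast0LessThan)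
  finally show ?thesis .
qed

lemma finite_set_replicate_pmf:
  assumes "finite (set_pmf P)"
  shows "finite (set_pmf (replicate_pmf m P))"
  using finite_lists_length_eq[OF assms, of m] by (simp add: set_replicate_pmf lists_eq_set)

lemma expectation_replicate_pmf_Suc:
  fixes F :: "'a list \<Rightarrow> real"
  assumes "finite (set_pmf P)"
  shows "measure_pmf.expectation (replicate_pmf (Suc m) P) F
    = measure_pmf.expectation P (\<lambda>x. measure_pmf.expectation (replicate_pmf m P) (\<lambda>xs. F (x # xs)))"
proof -
  have "replicate_pmf (Suc m) P = bind_pmf P (\<lambda>x. map_pmf ((#) x) (replicate_pmf m P))"
    by (simp add: map_pmf_def)
  then show ?thesis
    using assms finite_set_replicate_pmf[OF assms, of m]
    by (simp add: pmf_expectation_bind[of "set_pmf P"] integral_measure_pmf[of "set_pmf P"])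
qed

text \<open>The mixed terms of the square vanish because the summands are independent and centred.
  The second claim uses the first in its induction step, hence the joint proof.\<close>

lemma expectation_sum_list_replicate_pmf:
  fixes g :: "'a \<Rightarrow> real"
  assumes fin: "finite (set_pmf P)" and mean: "measure_pmf.expectation P g = 0"
  shows "measure_pmf.expectation (replicate_pmf m P) (\<lambda>xs. \<Sum>x\<leftarrow>xs. g x) = 0"
    and "measure_pmf.expectation (replicate_pmf m P) (\<lambda>xs. (\<Sum>x\<leftarrow>xs. g x)\<^sup>2)
      = real m * measure_pmf.expectation P (\<lambda>x. (g x)\<^sup>2)"
proof (induction m)
  case 0
  { case 1 then show ?case by simp
  next case 2 then show ?case by simp }
next
  case (Suc m)
  note int = integrable_measure_pmf_finite[OF fin]
    and int' = integrable_measure_pmf_finite[OF finite_set_replicate_pmf[OF fin, of m]]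
  { case 1
    show ?case
      using Suc mean by (simp add: expectation_replicate_pmf_Suc[OF fin] int int' del: replicate_pmf.simps)
  next
    case 2
    have "measure_pmf.expectation (replicate_pmf m P) (\<lambda>xs. (g x + (\<Sum>x\<leftarrow>xs. g x))\<^sup>2)
        = (g x)\<^sup>2 + real m * measure_pmf.expectation P (\<lambda>x. (g x)\<^sup>2)" for x
      using Suc by (simp add: power2_sum int')
    then show ?case
      by (simp add: expectation_replicate_pmf_Suc[OF fin] int algebra_simps del: replicate_pmf.simps)
  }
qed

text \<open>The arithmetic-geometric mean inequality with a free parameter \<open>s\<close> takes
  the place of the root of the variance. The bound is linear in the probability of \<open>c\<close>,
  so it can be summed over cells with one common \<open>s\<close>.\<close>

lemma expectation_empirical_deviation:
  assumes fin: "finite (set_pmf P)" and "0 < m" "0 < s"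
  shows "measure_pmf.expectation (replicate_pmf m P)
      (\<lambda>xs. \<bar>pmf (map_pmf f (empirical xs)) c - pmf (map_pmf f P) c\<bar>)
    \<le> (pmf (map_pmf f P) c / (real m * s) + s) / 2"
proof -
  define p where "p = pmf (map_pmf f P) c"
  define g where "g x = of_bool (f x = c) - p" for x
  note int = integrable_measure_pmf_finite[OF fin]
  note int' = integrable_measure_pmf_finite[OF finite_set_replicate_pmf[OF fin, of m]]
  have "(\<lambda>x. of_bool (f x = c) :: real) = indicator {x. f x = c}"
    by (auto simp: indicator_def)
  then have p: "measure_pmf.expectation P (\<lambda>x. of_bool (f x = c)) = p"
    by (simp add: p_def pmf_map vimage_def)
  have mean: "measure_pmf.expectation P g = 0"
    by (simp add: g_def[abs_def] int p)
  have "(g x)\<^sup>2 = (1 - 2 * p) * of_bool (f x = c) + p\<^sup>2" for x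
    by (simp add: g_def power2_eq_square algebra_simps)
  then have "measure_pmf.expectation P (\<lambda>x. (g x)\<^sup>2) = (1 - 2 * p) * p + p\<^sup>2"
    by (simp add: int p)
  also have "\<dots> \<le> p" by (simp add: power2_eq_square algebra_simps)
  finally have var: "measure_pmf.expectation P (\<lambda>x. (g x)\<^sup>2) \<le> p" .
  have dev: "pmf (map_pmf f (empirical xs)) c - p = (\<Sum>x\<leftarrow>xs. g x) / real m" if "length xs = m" for xs
  proof -
    have "(\<Sum>x\<leftarrow>xs. g x) = (\<Sum>x\<leftarrow>xs. of_bool (f x = c)) - real m * p"
      using that by (simp add: g_def[abs_def] sum_list_subtractf sum_list_const_mult sum_list_triv)
    moreover have "xs \<noteq> []" using that assms(2) by auto
    ultimately show ?thesis
      using that assms(2) by (simp add: pmf_map_empirical diff_divide_distrib)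
  qed
  have am_gm: "\<bar>z\<bar> \<le> (z\<^sup>2 / s + s) / 2" for z :: real
  proof -
    have "0 \<le> (\<bar>z\<bar> - s)\<^sup>2" by simp
    then show ?thesis using assms(3) by (simp add: field_simps power2_eq_square)
  qed
  have "measure_pmf.expectation (replicate_pmf m P) (\<lambda>xs. \<bar>pmf (map_pmf f (empirical xs)) c - p\<bar>)
      \<le> measure_pmf.expectation (replicate_pmf m P)
          (\<lambda>xs. ((\<Sum>x\<leftarrow>xs. g x)\<^sup>2 / ((real m)\<^sup>2 * s) + s) / 2)"
  proof (intro integral_mono_AE int' AE_pmfI)
    fix xs assume "xs \<in> set_pmf (replicate_pmf m P)"
    then have "length xs = m" by (simp add: set_replicate_pmf)
    from am_gm[of "(\<Sum>x\<leftarrow>xs. g x) / real m"]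
    show "\<bar>pmf (map_pmf f (empirical xs)) c - p\<bar> \<le> ((\<Sum>x\<leftarrow>xs. g x)\<^sup>2 / ((real m)\<^sup>2 * s) + s) / 2"
      unfolding dev[OF \<open>length xs = m\<close>] by (simp add: power_divide)
  qed
  also have "\<dots> = (real m * measure_pmf.expectation P (\<lambda>x. (g x)\<^sup>2) / ((real m)\<^sup>2 * s) + s) / 2"
    by (simp add: int' expectation_sum_list_replicate_pmf(2)[OF fin mean])
  also have "\<dots> = (measure_pmf.expectation P (\<lambda>x. (g x)\<^sup>2) / (real m * s) + s) / 2"
    using assms by (simp add: power2_eq_square)
  also have "\<dots> \<le> (p / (real m * s) + s) / 2"
    using var assms by (intro divide_right_mono add_right_mono) auto
  finally show ?thesis by (simp add: p_def)
qed

text \<open>With \<open>s = 1 / (u * v)\<close> in every cell, both terms of the summed deviation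
  bound become \<open>u / v\<close>; this replaces a use of Cauchy-Schwarz.\<close>

lemma expectation_l1_dist_empirical:
  assumes fin: "finite A" "f ` set_pmf P \<subseteq> A" "finite (set_pmf P)" and "0 < m"
  shows "measure_pmf.expectation (replicate_pmf m P)
      (\<lambda>xs. l1_dist (map_pmf f (empirical xs)) (map_pmf f P)) \<le> sqrt (card A / real m)"
proof -
  define u v where "u = sqrt (card A)" and "v = sqrt m"
  have "A \<noteq> {}" using fin(2) set_pmf_not_empty[of P] by blast
  then have uv: "0 < u" "0 < v" "real (card A) = u * u" "real m = v * v"
    using assms by (auto simp: u_def v_def card_gt_0_iff)
  note int' = integrable_measure_pmf_finite[OF finite_set_replicate_pmf[OF fin(3), of m]]
  have "measure_pmf.expectation (replicate_pmf m P)
      (\<lambda>xs. l1_dist (map_pmf f (empirical xs)) (map_pmf f P))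
    = measure_pmf.expectation (replicate_pmf m P)
      (\<lambda>xs. \<Sum>c\<in>A. \<bar>pmf (map_pmf f (empirical xs)) c - pmf (map_pmf f P) c\<bar>)"
  proof (intro integral_cong_AE AE_pmfI)
    fix xs assume xs: "xs \<in> set_pmf (replicate_pmf m P)"
    then have "xs \<noteq> []" "set xs \<subseteq> set_pmf P"
      using assms(4) by (auto simp: set_replicate_pmf)
    then show "l1_dist (map_pmf f (empirical xs)) (map_pmf f P)
        = (\<Sum>c\<in>A. \<bar>pmf (map_pmf f (empirical xs)) c - pmf (map_pmf f P) c\<bar>)"
      using fin by (intro l1_dist_eq_sum) (auto simp: set_pmf_empirical)
  qed auto
  also have "\<dots> = (\<Sum>c\<in>A. measure_pmf.expectation (replicate_pmf m P)
      (\<lambda>xs. \<bar>pmf (map_pmf f (empirical xs)) c - pmf (map_pmf f P) c\<bar>))"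
    by (intro Bochner_Integration.integral_sum int')
  also have "\<dots> \<le> (\<Sum>c\<in>A. (pmf (map_pmf f P) c / (real m * (1 / (u * v))) + 1 / (u * v)) / 2)"
    using uv assms(4) by (intro sum_mono expectation_empirical_deviation fin) auto
  also have "\<dots> = (1 / (real m * (1 / (u * v))) + card A * (1 / (u * v))) / 2"
    using fin by (simp add: sum_divide_distrib[symmetric] sum.distrib sum_pmf_eq_1 set_map_pmf
        del: divide_divide_eq_right)
  also have "\<dots> = u / v"
    using uv by (simp add: field_simps)
  finally show ?thesis by (simp add: u_def v_def real_sqrt_divide)
qed

section \<open>The hierarchy of dyadic grids\<close>

definition halve :: "point \<Rightarrow> point" where
  "halve x = (fst x div 2, snd x div 2)"

text \<open>Coordinates run from 1 to \<open>n\<close>; dividing by \<open>n + 1\<close> keeps the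
  last one in a cell of index below \<open>2 ^ L\<close>.\<close>

definition finest_cell :: "nat \<Rightarrow> nat \<Rightarrow> point \<Rightarrow> point" where
  "finest_cell n L x = (fst x * 2 ^ L div (int n + 1), snd x * 2 ^ L div (int n + 1))"

lemma halve_funpow: "(halve ^^ i) x = (fst x div 2 ^ i, snd x div 2 ^ i)"
  by (induction i) (simp_all add: halve_def zdiv_zmult2_eq[symmetric] mult.commute)

text \<open>The weight \<open>2 ^ i / 2 ^ L\<close> is the relative side length of a cell of level
  \<open>i\<close>. Level \<open>L\<close> is left out: it has a single cell, on which any two
  distributions agree.\<close>

definition multiscale_dist :: "nat \<Rightarrow> point pmf \<Rightarrow> point pmf \<Rightarrow> real" where
  "multiscale_dist L P Q =
     (\<Sum>i<L. 2 ^ i / 2 ^ L * l1_dist (map_pmf (halve ^^ i) P) (map_pmf (halve ^^ i) Q))"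

lemma multiscale_dist_triangle:
  assumes "finite (set_pmf P)" "finite (set_pmf Q)" "finite (set_pmf R)"
  shows "multiscale_dist L P R \<le> multiscale_dist L P Q + multiscale_dist L Q R"
  unfolding multiscale_dist_def sum.distrib[symmetric] distrib_left[symmetric]
  by (intro sum_mono mult_left_mono l1_dist_triangle) (use assms in auto)

lemma multiscale_dist_commute: "multiscale_dist L P Q = multiscale_dist L Q P"
  by (simp add: multiscale_dist_def l1_dist_commute)

lemma multiscale_dist_nonneg: "0 \<le> multiscale_dist L P Q"
  unfolding multiscale_dist_def by (intro sum_nonneg) (simp add: l1_dist_nonneg)

lemma int_div_less:
  fixes a b c :: int
  assumes "0 < b" "a < c * b"
  shows "a div b < c"
proof -
  have "a div b * b < c * b"
    using assms div_mult_mod_eq[of a b] pos_mod_sign[of b a] by linarith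
  then show ?thesis using assms(1) by simp
qed

text \<open>Level \<open>i\<close> has \<open>4 ^ (L - i)\<close> cells, hence an expected l1 deviation of \<open>2 ^ (L - i) / M\<close>, which its
  weight in the sum balances exactly.\<close>

lemma expectation_multiscale_dist_empirical:
  assumes P: "set_pmf P \<subseteq> {0..<2 ^ L} \<times> {0..<2 ^ L}" and "0 < M"
  shows "measure_pmf.expectation (replicate_pmf (M\<^sup>2) P) (\<lambda>xs. multiscale_dist L (empirical xs) P)
    \<le> L / M"
proof -
  have fin: "finite (set_pmf P)" by (rule finite_subset[OF P]) auto
  note int' = integrable_measure_pmf_finite[OF finite_set_replicate_pmf[OF fin, of "M\<^sup>2"]]
  have "measure_pmf.expectation (replicate_pmf (M\<^sup>2) P) (\<lambda>xs. multiscale_dist L (empirical xs) P)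
    = (\<Sum>i<L. 2 ^ i / 2 ^ L * measure_pmf.expectation (replicate_pmf (M\<^sup>2) P)
        (\<lambda>xs. l1_dist (map_pmf (halve ^^ i) (empirical xs)) (map_pmf (halve ^^ i) P)))"
    unfolding multiscale_dist_def by (subst Bochner_Integration.integral_sum) (auto intro: int')
  also have "\<dots> \<le> (\<Sum>i<L. 1 / real M)"
  proof (rule sum_mono)
    fix i assume "i \<in> {..<L}"
    then have L: "(2 :: 'b :: linordered_idom) ^ L = 2 ^ (L - i) * 2 ^ i"
      by (simp flip: power_add)
    let ?I = "{0..<2 ^ (L - i)} :: int set"
    have div: "c div 2 ^ i \<in> ?I" if "c \<in> {0..<2 ^ L}" for c :: int
      using that by (auto simp: L pos_imp_zdiv_nonneg_iff intro!: int_div_less)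
    have "(halve ^^ i) ` set_pmf P \<subseteq> ?I \<times> ?I"
    proof
      fix y assume "y \<in> (halve ^^ i) ` set_pmf P"
      then obtain x where x: "x \<in> set_pmf P" "y = (fst x div 2 ^ i, snd x div 2 ^ i)"
        by (auto simp: halve_funpow)
      then have "fst x \<in> {0..<2 ^ L}" "snd x \<in> {0..<2 ^ L}" using P by auto
      then show "y \<in> ?I \<times> ?I" using div x by blast
    qed
    then have "measure_pmf.expectation (replicate_pmf (M\<^sup>2) P)
        (\<lambda>xs. l1_dist (map_pmf (halve ^^ i) (empirical xs)) (map_pmf (halve ^^ i) P))
      \<le> sqrt (card (?I \<times> ?I) / real (M\<^sup>2))"
      using fin assms(2) by (intro expectation_l1_dist_empirical) auto
    also have "\<dots> = 2 ^ (L - i) / real M"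
      by (simp add: card_cartesian_product real_sqrt_divide nat_power_eq)
    finally have "2 ^ i / 2 ^ L * measure_pmf.expectation (replicate_pmf (M\<^sup>2) P)
        (\<lambda>xs. l1_dist (map_pmf (halve ^^ i) (empirical xs)) (map_pmf (halve ^^ i) P))
      \<le> 2 ^ i / 2 ^ L * (2 ^ (L - i) / real M)"
      by (intro mult_left_mono) auto
    also have "\<dots> = 1 / real M" by (simp add: L)
    finally show "2 ^ i / 2 ^ L * measure_pmf.expectation (replicate_pmf (M\<^sup>2) P)
        (\<lambda>xs. l1_dist (map_pmf (halve ^^ i) (empirical xs)) (map_pmf (halve ^^ i) P)) \<le> 1 / real M" .
  qed
  finally show ?thesis by simp
qed

text \<open>Markov's inequality is enough, as the tester needs only constant confidence.\<close>

lemma prob_multiscale_dist_empirical: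
  assumes P: "set_pmf P \<subseteq> {0..<2 ^ L} \<times> {0..<2 ^ L}" and "0 < M" "0 < T"
  shows "measure_pmf.prob (replicate_pmf (M\<^sup>2) P) {xs. T \<le> multiscale_dist L (empirical xs) P}
    \<le> L / M / T"
proof -
  have fin: "finite (set_pmf P)" by (rule finite_subset[OF P]) auto
  have "measure_pmf.prob (replicate_pmf (M\<^sup>2) P)
      {xs \<in> space (replicate_pmf (M\<^sup>2) P). T \<le> multiscale_dist L (empirical xs) P}
    \<le> measure_pmf.expectation (replicate_pmf (M\<^sup>2) P) (\<lambda>xs. multiscale_dist L (empirical xs) P) / T"
    by (rule integral_Markov_inequality_measure)
      (auto simp: assms multiscale_dist_nonneg
        intro!: integrable_measure_pmf_finite finite_set_replicate_pmf[OF fin])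
  also have "\<dots> \<le> L / M / T"
    using assms expectation_multiscale_dist_empirical[OF P] by (intro divide_right_mono) auto
  finally show ?thesis by simp
qed

lemma finest_cell_in_box:
  assumes "x \<in> grid n"
  shows "finest_cell n L x \<in> {0..<2 ^ L} \<times> {0..<2 ^ L}"
proof -
  have "c * 2 ^ L div (int n + 1) \<in> {0..<2 ^ L}" if "c \<in> {1..int n}" for c
    using that by (auto simp: pos_imp_zdiv_nonneg_iff mult.commute intro!: int_div_less)
  then show ?thesis using assms by (auto simp: finest_cell_def grid_def)
qed

text \<open>A cell of level \<open>i\<close> has side \<open>(n + 1) * 2 ^ i / 2 ^ L\<close>; the
  factor 2 absorbs \<open>n + 1\<close> into \<open>2 * n\<close>.\<close>

lemma sup_dist_same_cell:
  assumes "1 \<le> n" "(halve ^^ i) (finest_cell n L x) = (halve ^^ i) (finest_cell n L y)"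
  shows "sup_dist n x y \<le> 2 * 2 ^ i / 2 ^ L"
proof -
  have bound: "\<bar>c - e\<bar> * 2 ^ L \<le> 2 * int n * 2 ^ i"
    if "c * 2 ^ L div (int n + 1) div 2 ^ i = e * 2 ^ L div (int n + 1) div 2 ^ i" for c e
  proof -
    define N where "N = (int n + 1) * 2 ^ i"
    define q where "q = c * 2 ^ L div N"
    have N: "0 < N" by (simp add: N_def)
    have q': "q = e * 2 ^ L div N"
      using that by (simp add: q_def N_def zdiv_zmult2_eq)
    have "q * N \<le> c * 2 ^ L" "c * 2 ^ L < q * N + N" "q * N \<le> e * 2 ^ L" "e * 2 ^ L < q * N + N"
      using N pos_mod_sign[of N "c * 2 ^ L"] pos_mod_bound[of N "c * 2 ^ L"]
        pos_mod_sign[of N "e * 2 ^ L"] pos_mod_bound[of N "e * 2 ^ L"]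
        div_mult_mod_eq[of "c * 2 ^ L" N] div_mult_mod_eq[of "e * 2 ^ L" N]
      unfolding q_def[symmetric] q'[symmetric] by linarith+
    then have "\<bar>c * 2 ^ L - e * 2 ^ L\<bar> \<le> N" by linarith
    also have "c * 2 ^ L - e * 2 ^ L = (c - e) * 2 ^ L" by (simp add: algebra_simps)
    also have "N \<le> 2 * int n * 2 ^ i" using assms(1) by (simp add: N_def)
    finally show ?thesis by (simp add: abs_mult)
  qed
  have "\<bar>fst x - fst y\<bar> * 2 ^ L \<le> 2 * int n * 2 ^ i" "\<bar>snd x - snd y\<bar> * 2 ^ L \<le> 2 * int n * 2 ^ i"
    using assms(2) by (auto simp: halve_funpow finest_cell_def intro!: bound)
  then have "max \<bar>fst x - fst y\<bar> \<bar>snd x - snd y\<bar> * 2 ^ L \<le> 2 * int n * 2 ^ i"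
    by (simp add: max_def)
  then have "real_of_int (max \<bar>fst x - fst y\<bar> \<bar>snd x - snd y\<bar> * 2 ^ L) \<le> real_of_int (2 * int n * 2 ^ i)"
    by (subst of_int_le_iff)
  then show ?thesis
    using assms(1) unfolding sup_dist_def of_int_mult by (simp add: field_simps)
qed

text \<open>The coarsest level \<open>i\<close> that separates the points pays for the whole
  distance: they share a cell of level \<open>i + 1\<close>, and
  \<open>2 * 2 ^ (i + 1) = 4 * 2 ^ i\<close>. Points that no level separates share a finest cell and
  are covered by \<open>2 / 2 ^ L\<close>.\<close>

lemma sup_dist_le_multiscale:
  fixes L :: nat
  assumes "1 \<le> n" "x \<in> grid n" "y \<in> grid n"
  defines "f \<equiv> finest_cell n L"
  shows "sup_dist n x y
    \<le> 2 / 2 ^ L + (\<Sum>i<L. 4 * 2 ^ i / 2 ^ L * of_bool ((halve ^^ i) (f x) \<noteq> (halve ^^ i) (f y)))"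
proof -
  define t :: "nat \<Rightarrow> real" where "t i = 4 * 2 ^ i / 2 ^ L * of_bool ((halve ^^ i) (f x) \<noteq> (halve ^^ i) (f y))" for i
  have "sup_dist n x y \<le> 2 / 2 ^ L + sum t {..<k}" if "(halve ^^ k) (f x) = (halve ^^ k) (f y)" for k
    using that
  proof (induction k)
    case 0
    then show ?case using sup_dist_same_cell[of n 0 L x y] assms by simp
  next
    case (Suc k)
    show ?case
    proof (cases "(halve ^^ k) (f x) = (halve ^^ k) (f y)")
      case True
      then show ?thesis using Suc.IH by (simp add: t_def)
    next
      case False
      have "sup_dist n x y \<le> 2 * 2 ^ Suc k / 2 ^ L"
        using Suc.prems assms by (intro sup_dist_same_cell) auto
      also have "\<dots> = t k" using False by (simp add: t_def)
      moreover have "0 \<le> sum t {..<k}" by (intro sum_nonneg) (simp add: t_def)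
      moreover have "0 \<le> (2 :: real) / 2 ^ L" by simp
      ultimately show ?thesis unfolding sum.lessThan_Suc by linarith
    qed
  qed
  moreover have "(halve ^^ L) (f z) = (0, 0)" if "z \<in> grid n" for z
    using finest_cell_in_box[OF that, of L] by (auto simp: halve_funpow f_def mem_Times_iff)
  ultimately show ?thesis using assms by (simp add: t_def)
qed

section \<open>Bounding the earth mover's distance\<close>

text \<open>Nonnegativity of \<open>d\<close> bounds the costs of all couplings below; the infimum
  of an unbounded set of reals would be unspecified.\<close>

lemma emd_le_coupling:
  assumes "\<pi> \<in> couplings \<mu> \<nu>" "\<And>x y. 0 \<le> d x y"
  shows "emd d \<mu> \<nu> \<le> measure_pmf.expectation \<pi> (\<lambda>(x, y). d x y)"
  unfolding emd_def
proof (rule cINF_lower[OF _ assms(1)])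
  show "bdd_below ((\<lambda>\<pi>. measure_pmf.expectation \<pi> (\<lambda>(x, y). d x y)) ` couplings \<mu> \<nu>)"
    using assms(2) by (intro bdd_belowI2[where m = 0] Bochner_Integration.integral_nonneg) auto
qed

lemma couplings_support:
  assumes "\<pi> \<in> couplings \<mu> \<nu>"
  shows "set_pmf \<pi> \<subseteq> set_pmf \<mu> \<times> set_pmf \<nu>"
  using assms by (force simp: couplings_def)

text \<open>Mass travels from \<open>x\<close> to \<open>F x\<close>, on to \<open>F y\<close> and
  then to \<open>y\<close>, where \<open>F\<close> will be the labelling. The middle leg is charged
  with the multiscale coupling of the cells of \<open>F x\<close> and \<open>F y\<close>, lifted to
  \<open>\<mu>\<close> and \<open>\<nu>\<close>; the weight 4 and the half in total variation leave
  the factor 2.\<close>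

lemma emd_le_multiscale:
  fixes L :: nat
  assumes "1 \<le> n" and d: "\<And>x y. 0 \<le> d x y" "\<And>x y. d x y \<le> sup_dist n x y"
    and supp: "set_pmf \<mu> \<subseteq> grid n" "set_pmf \<nu> \<subseteq> grid n"
    and F: "\<And>x. x \<in> grid n \<Longrightarrow> F x \<in> grid n"
  defines "f \<equiv> \<lambda>x. finest_cell n L (F x)"
  shows "emd d \<mu> \<nu> \<le> measure_pmf.expectation \<mu> (\<lambda>x. sup_dist n x (F x))
    + measure_pmf.expectation \<nu> (\<lambda>x. sup_dist n x (F x))
    + 2 / 2 ^ L + 2 * multiscale_dist L (map_pmf f \<mu>) (map_pmf f \<nu>)"
proof -
  let ?S = "\<lambda>x y. sup_dist n x y"
  have fin: "finite (set_pmf \<mu>)" "finite (set_pmf \<nu>)"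
    using supp finite_grid by (auto intro: finite_subset)
  obtain \<pi>' where \<pi>': "\<pi>' \<in> couplings (map_pmf f \<mu>) (map_pmf f \<nu>)"
    "\<And>i. i < L \<Longrightarrow> measure_pmf.prob \<pi>' {(x, y). (halve ^^ i) x \<noteq> (halve ^^ i) y}
      \<le> l1_dist (map_pmf (halve ^^ i) (map_pmf f \<mu>)) (map_pmf (halve ^^ i) (map_pmf f \<nu>)) / 2"
    using multiscale_coupling[of "map_pmf f \<mu>" "map_pmf f \<nu>" L halve] fin by auto
  obtain \<pi> where \<pi>: "\<pi> \<in> couplings \<mu> \<nu>" "map_pmf (map_prod f f) \<pi> = \<pi>'"
    using coupling_lift[OF \<pi>'(1)] by blast
  have supp_\<pi>: "set_pmf \<pi> \<subseteq> grid n \<times> grid n"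
    using couplings_support[OF \<pi>(1)] supp by blast
  then have "finite (set_pmf \<pi>)" using finite_grid by (auto intro: finite_subset)
  note int = integrable_measure_pmf_finite[OF this]
  let ?b = "\<lambda>i z. of_bool ((halve ^^ i) (f (fst z)) \<noteq> (halve ^^ i) (f (snd z))) :: real"
  have "emd d \<mu> \<nu> \<le> measure_pmf.expectation \<pi> (\<lambda>(x, y). d x y)"
    by (intro emd_le_coupling \<pi> d)
  also have "\<dots> \<le> measure_pmf.expectation \<pi> (\<lambda>z. ?S (fst z) (F (fst z)) + ?S (snd z) (F (snd z))
      + 2 / 2 ^ L + (\<Sum>i<L. 4 * 2 ^ i / 2 ^ L * ?b i z))"
  proof (intro integral_mono_AE int AE_pmfI)
    fix z assume "z \<in> set_pmf \<pi>"
    then obtain x y where z: "z = (x, y)" "x \<in> grid n" "y \<in> grid n" using supp_\<pi> by auto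
    have "?S x y \<le> ?S x (F x) + (?S (F x) (F y) + ?S (F y) y)"
      by (meson add_left_mono order_trans sup_dist_triangle)
    also have "?S (F x) (F y) \<le> 2 / 2 ^ L + (\<Sum>i<L. 4 * 2 ^ i / 2 ^ L * ?b i z)"
      unfolding z f_def fst_conv snd_conv using assms z by (intro sup_dist_le_multiscale) auto
    finally show "(case z of (x, y) \<Rightarrow> d x y) \<le> ?S (fst z) (F (fst z)) + ?S (snd z) (F (snd z))
        + 2 / 2 ^ L + (\<Sum>i<L. 4 * 2 ^ i / 2 ^ L * ?b i z)"
      using d(2)[of x y] by (simp add: z sup_dist_commute[of n "F y"])
  qed
  also have "\<dots> = measure_pmf.expectation \<pi> (\<lambda>z. ?S (fst z) (F (fst z)))
      + measure_pmf.expectation \<pi> (\<lambda>z. ?S (snd z) (F (snd z))) + 2 / 2 ^ L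
      + (\<Sum>i<L. 4 * 2 ^ i / 2 ^ L * measure_pmf.expectation \<pi> (?b i))"
    by (simp add: int)
  also have "measure_pmf.expectation \<pi> (\<lambda>z. ?S (fst z) (F (fst z)))
      = measure_pmf.expectation (map_pmf fst \<pi>) (\<lambda>x. ?S x (F x))" by simp
  also have "map_pmf fst \<pi> = \<mu>" using \<pi>(1) by (simp add: couplings_def)
  also have "measure_pmf.expectation \<pi> (\<lambda>z. ?S (snd z) (F (snd z)))
      = measure_pmf.expectation (map_pmf snd \<pi>) (\<lambda>x. ?S x (F x))" by simp
  also have "map_pmf snd \<pi> = \<nu>" using \<pi>(1) by (simp add: couplings_def)
  also have "(\<Sum>i<L. 4 * 2 ^ i / 2 ^ L * measure_pmf.expectation \<pi> (?b i))
      \<le> (\<Sum>i<L. 2 * (2 ^ i / 2 ^ L * l1_dist (map_pmf (halve ^^ i) (map_pmf f \<mu>)) (map_pmf (halve ^^ i) (map_pmf f \<nu>))))"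
  proof (rule sum_mono)
    fix i assume "i \<in> {..<L}"
    have "?b i = indicator (map_prod f f -` {(x, y). (halve ^^ i) x \<noteq> (halve ^^ i) y})"
      by (auto simp: indicator_def)
    then have "measure_pmf.expectation \<pi> (?b i) = measure_pmf.prob \<pi>' {(x, y). (halve ^^ i) x \<noteq> (halve ^^ i) y}"
      by (simp add: \<pi>(2)[symmetric])
    also have "\<dots> \<le> l1_dist (map_pmf (halve ^^ i) (map_pmf f \<mu>)) (map_pmf (halve ^^ i) (map_pmf f \<nu>)) / 2"
      using \<open>i \<in> {..<L}\<close> by (intro \<pi>'(2)) simp
    finally have "4 * 2 ^ i / 2 ^ L * measure_pmf.expectation \<pi> (?b i) \<le> 4 * 2 ^ i / 2 ^ L
        * (l1_dist (map_pmf (halve ^^ i) (map_pmf f \<mu>)) (map_pmf (halve ^^ i) (map_pmf f \<nu>)) / 2)"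
      by (intro mult_left_mono) auto
    then show "4 * 2 ^ i / 2 ^ L * measure_pmf.expectation \<pi> (?b i)
        \<le> 2 * (2 ^ i / 2 ^ L * l1_dist (map_pmf (halve ^^ i) (map_pmf f \<mu>)) (map_pmf (halve ^^ i) (map_pmf f \<nu>)))"
      by simp
  qed
  also have "\<dots> = 2 * multiscale_dist L (map_pmf f \<mu>) (map_pmf f \<nu>)"
    by (simp add: multiscale_dist_def sum_distrib_left)
  finally show ?thesis by simp
qed

section \<open>Oracle programs\<close>

lemma within_budget_mono:
  "within_budget X A s q \<Longrightarrow> s \<le> s' \<Longrightarrow> q \<le> q' \<Longrightarrow> within_budget X A s' q'"
proof (induction A arbitrary: s q s' q')
  case (Sample_fst f)
  have "within_budget X (f y) (s' - 1) q'" if "y \<in> X" for y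
    using Sample_fst.prems that by (simp add: Sample_fst.IH[OF rangeI, of _ "s - 1" q])
  then show ?case using Sample_fst.prems by simp
next
  case (Sample_snd f)
  have "within_budget X (f y) (s' - 1) q'" if "y \<in> X" for y
    using Sample_snd.prems that by (simp add: Sample_snd.IH[OF rangeI, of _ "s - 1" q])
  then show ?case using Sample_snd.prems by simp
next
  case (Query x f)
  have "within_budget X (f y) s' (q' - 1)" if "y \<in> X" for y
    using Query.prems that by (simp add: Query.IH[OF rangeI, of _ s "q - 1"])
  then show ?case using Query.prems by simp
next
  case (Random r f)
  have "within_budget X (f y) s' q'" if "y \<in> set_pmf r" for y
    using Random.prems that by (simp add: Random.IH[OF rangeI, of _ s q])
  then show ?case using Random.prems by simp
qed auto

section \<open>Membership queries, binary search and the check of a cell\<close>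

text \<open>When \<open>r\<close> is a label, this is membership in the cell of \<open>r\<close>,
  because distinct cells have distinct representatives (\<open>label_eq_iff\<close>).\<close>

definition in_cell :: "nat \<Rightarrow> (point \<Rightarrow> point) \<Rightarrow> point \<Rightarrow> point \<Rightarrow> bool" where
  "in_cell n lab r p \<longleftrightarrow> p \<in> grid n \<and> lab p = r"

text \<open>Points outside the grid may not be queried; they are known to lie in no cell.\<close>

definition ask :: "nat \<Rightarrow> point \<Rightarrow> point \<Rightarrow> (bool \<Rightarrow> point algorithm) \<Rightarrow> point algorithm" where
  "ask n p r k = (if p \<in> grid n then Query p (\<lambda>y. k (y = r)) else k False)"

lemma run_ask: "run lab \<mu> \<nu> (ask n p r k) = run lab \<mu> \<nu> (k (in_cell n lab r p))"
  by (simp add: ask_def in_cell_def)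

lemma within_budget_ask:
  assumes "\<And>b. within_budget (grid n) (k b) s q"
  shows "within_budget (grid n) (ask n p r k) s (Suc q)"
  using assms within_budget_mono[OF assms[of False], of s "Suc q"] by (simp add: ask_def)

text \<open>Algorithms return only verdicts, so the result of the search is handed to a continuation
  \<open>k\<close>. The binary digits of the offset are fixed from the highest down with
  \<open>j\<close> queries; \<open>bisect\<close> is the pure counterpart.\<close>

primrec extent :: "nat \<Rightarrow> (int \<Rightarrow> point) \<Rightarrow> point \<Rightarrow> nat \<Rightarrow> int \<Rightarrow> (int \<Rightarrow> point algorithm)
    \<Rightarrow> point algorithm" where
  "extent n g r 0 e k = k e"
| "extent n g r (Suc j) e k =
     ask n (g (e + 2 ^ j)) r (\<lambda>b. extent n g r j (if b then e + 2 ^ j else e) k)"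

primrec bisect :: "(int \<Rightarrow> bool) \<Rightarrow> nat \<Rightarrow> int \<Rightarrow> int" where
  "bisect P 0 e = e"
| "bisect P (Suc j) e = bisect P j (if P (e + 2 ^ j) then e + 2 ^ j else e)"

lemma run_extent:
  "run lab \<mu> \<nu> (extent n g r j e k) = run lab \<mu> \<nu> (k (bisect (\<lambda>i. in_cell n lab r (g i)) j e))"
  by (induction j arbitrary: e) (simp_all add: run_ask)

lemma within_budget_extent:
  assumes "\<And>e. within_budget (grid n) (k e) s q"
  shows "within_budget (grid n) (extent n g r j e k) s (j + q)"
  by (induction j arbitrary: e) (simp_all add: assms within_budget_ask)

lemma bisect_ge: "e \<le> bisect P j e"
proof (induction j arbitrary: e)
  case (Suc j)
  have "e \<le> (if P (e + 2 ^ j) then e + 2 ^ j else e)" by simp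
  also have "\<dots> \<le> bisect P (Suc j) e" using Suc by simp
  finally show ?case .
qed simp

text \<open>The hypothesis is the invariant of the search. It holds for any predicate, monotone or
  not, and at \<open>j = 0\<close> it says that a boundary has been found.\<close>

lemma bisect_boundary:
  assumes "P e" "\<not> P (e + 2 ^ j)"
  shows "P (bisect P j e) \<and> \<not> P (bisect P j e + 1)"
  using assms by (induction j arbitrary: e) (auto simp: algebra_simps)

primrec expect :: "nat \<Rightarrow> point \<Rightarrow> bool \<Rightarrow> point list \<Rightarrow> point algorithm \<Rightarrow> point algorithm
    \<Rightarrow> point algorithm" where
  "expect n r b [] A B = A"
| "expect n r b (p # ps) A B = ask n p r (\<lambda>c. if c = b then expect n r b ps A B else B)"

lemma run_expect:
  "run lab \<mu> \<nu> (expect n r b ps A B)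
    = (if \<forall>p\<in>set ps. in_cell n lab r p = b then run lab \<mu> \<nu> A else run lab \<mu> \<nu> B)"
  by (induction ps) (auto simp: run_ask)

lemma within_budget_expect:
  assumes "within_budget (grid n) A s q" "within_budget (grid n) B s q"
  shows "within_budget (grid n) (expect n r b ps A B) s (length ps + q)"
proof (induction ps)
  case (Cons p ps)
  have "within_budget (grid n) B s (length ps + q)"
    using assms(2) by (rule within_budget_mono) auto
  with Cons show ?case by (auto intro: within_budget_ask)
qed (simp add: assms)

text \<open>The four searches yield a box; it is only guaranteed to be related to the cell of \<open>r\<close> if that
  cell is a box as well. The further queries and the bound \<open>l\<close> on the side lengths make sure that the
  cell is not much larger than the box, whatever the searches returned.\<close>

definition check_cell :: "nat \<Rightarrow> nat \<Rightarrow> real \<Rightarrow> point \<Rightarrow> point algorithm \<Rightarrow> point algorithm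
    \<Rightarrow> point algorithm" where
  "check_cell n J l r A B =
     extent n (\<lambda>e. (fst r - e, snd r)) r J 0 (\<lambda>w.
     extent n (\<lambda>e. (fst r + e, snd r)) r J 0 (\<lambda>x.
     extent n (\<lambda>e. (fst r, snd r - e)) r J 0 (\<lambda>y.
     extent n (\<lambda>e. (fst r, snd r + e)) r J 0 (\<lambda>z.
       if of_int (w + x) \<le> l \<and> of_int (y + z) \<le> l
       then expect n r True (corners (fst r - w) (fst r + x) (snd r - y) (snd r + z))
         (expect n r False (rim (fst r - w) (fst r + x) (snd r - y) (snd r + z)) A B) B
       else B))))"

definition passes :: "nat \<Rightarrow> (point \<Rightarrow> point) \<Rightarrow> nat \<Rightarrow> real \<Rightarrow> point \<Rightarrow> bool" where
  "passes n lab J l r \<longleftrightarrow>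
     (let P = in_cell n lab r;
          w = bisect (\<lambda>e. P (fst r - e, snd r)) J 0;
          x = bisect (\<lambda>e. P (fst r + e, snd r)) J 0;
          y = bisect (\<lambda>e. P (fst r, snd r - e)) J 0;
          z = bisect (\<lambda>e. P (fst r, snd r + e)) J 0
      in of_int (w + x) \<le> l \<and> of_int (y + z) \<le> l
        \<and> (\<forall>p\<in>set (corners (fst r - w) (fst r + x) (snd r - y) (snd r + z)). P p)
        \<and> (\<forall>p\<in>set (rim (fst r - w) (fst r + x) (snd r - y) (snd r + z)). \<not> P p))"

lemma run_check_cell:
  "run lab \<mu> \<nu> (check_cell n J l r A B)
    = (if passes n lab J l r then run lab \<mu> \<nu> A else run lab \<mu> \<nu> B)"
proof -
  define w where "w = bisect (\<lambda>e. in_cell n lab r (fst r - e, snd r)) J 0"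
  define x where "x = bisect (\<lambda>e. in_cell n lab r (fst r + e, snd r)) J 0"
  define y where "y = bisect (\<lambda>e. in_cell n lab r (fst r, snd r - e)) J 0"
  define z where "z = bisect (\<lambda>e. in_cell n lab r (fst r, snd r + e)) J 0"
  show ?thesis
    unfolding check_cell_def passes_def Let_def run_extent
      w_def[symmetric] x_def[symmetric] y_def[symmetric] z_def[symmetric]
    by (cases "of_int (w + x) \<le> l \<and> of_int (y + z) \<le> l") (auto simp: run_expect)
qed

lemma length_corners: "length (corners a b a' b') = 4"
  by (simp add: corners_def)

lemma length_rim: "length (rim a b a' b') = 12"
  by (simp add: rim_def Let_def)

lemma within_budget_check_cell:
  assumes A: "within_budget (grid n) A s q" and B: "within_budget (grid n) B s q"
  shows "within_budget (grid n) (check_cell n J l r A B) s (4 * J + 16 + q)"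
proof -
  have B': "within_budget (grid n) B s (12 + q)" "within_budget (grid n) B s (16 + q)"
    using B by (rule within_budget_mono; simp)+
  have "within_budget (grid n) (expect n r False (rim a b a' b') A B) s (12 + q)" for a b a' b'
    using within_budget_expect[OF A B, of r False "rim a b a' b'"] by (simp add: length_rim)
  then have "within_budget (grid n) (expect n r True (corners a b a' b')
      (expect n r False (rim a b a' b') A B) B) s (4 + (12 + q))" for a b a' b'
    using within_budget_expect[OF _ B'(1), of _ r True "corners a b a' b'"]
    by (simp add: length_corners)
  then have "within_budget (grid n) (check_cell n J l r A B) s (J + (J + (J + (J + (4 + (12 + q))))))"
    unfolding check_cell_def by (intro within_budget_extent) (auto simp: B'(2))
  then show ?thesis by (rule within_budget_mono) auto
qed

text \<open>Membership in a box is decided coordinate by coordinate. The boundaries found on the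
  cross through \<open>r\<close> are therefore boundaries along entire sides, which settles all
  corners and rim points.\<close>

lemma passes_box:
  assumes r: "r \<in> C" and box: "grid_box n C" and P: "\<And>p. in_cell n lab r p \<longleftrightarrow> p \<in> C"
    and J: "n < 2 ^ J"
    and small: "\<And>x y. x \<in> C \<Longrightarrow> y \<in> C \<Longrightarrow> of_int \<bar>fst x - fst y\<bar> \<le> l \<and> of_int \<bar>snd x - snd y\<bar> \<le> l"
  shows "passes n lab J l r"
proof -
  obtain a b a' b' where "C = {x \<in> grid n. a \<le> fst x \<and> fst x \<le> b \<and> a' \<le> snd x \<and> snd x \<le> b'}"
    using box unfolding grid_box_def by blast
  then have "\<exists>I I'. C = I \<times> I' \<and> I \<subseteq> {1..int n} \<and> I' \<subseteq> {1..int n}"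
    by (intro exI[of _ "{1..int n} \<inter> {a..b}"] exI[of _ "{1..int n} \<inter> {a'..b'}"])
      (auto simp: grid_def)
  then obtain I I' where C: "C = I \<times> I'" and sub: "I \<subseteq> {1..int n}" "I' \<subseteq> {1..int n}" by blast
  have in_I: "fst r \<in> I" "snd r \<in> I'" using r C by auto
  have J': "int n < 2 ^ J" using J by (metis of_nat_less_iff of_nat_numeral of_nat_power)
  define w where "w = bisect (\<lambda>e. in_cell n lab r (fst r - e, snd r)) J 0"
  define x where "x = bisect (\<lambda>e. in_cell n lab r (fst r + e, snd r)) J 0"
  define y where "y = bisect (\<lambda>e. in_cell n lab r (fst r, snd r - e)) J 0"
  define z where "z = bisect (\<lambda>e. in_cell n lab r (fst r, snd r + e)) J 0"
  \<comment> \<open>An offset of \<open>2 ^ J\<close> exceeds \<open>n\<close> and leaves the grid,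
    so the far end of each search fails, as \<open>bisect_boundary\<close> requires.\<close>
  have "c - 2 ^ J \<notin> K \<and> c + 2 ^ J \<notin> K" if "K \<subseteq> {1..int n}" "c \<in> K" for c and K :: "int set"
    using J' subsetD[OF that] subsetD[OF that(1), of "c - 2 ^ J"] subsetD[OF that(1), of "c + 2 ^ J"]
    by (smt (verit) atLeastAtMost_iff)
  then have out: "fst r - 2 ^ J \<notin> I" "fst r + 2 ^ J \<notin> I" "snd r - 2 ^ J \<notin> I'" "snd r + 2 ^ J \<notin> I'"
    using sub in_I by blast+
  have w: "fst r - w \<in> I" "fst r - w - 1 \<notin> I"
    using bisect_boundary[of "\<lambda>e. in_cell n lab r (fst r - e, snd r)" 0 J] in_I out
    unfolding w_def[symmetric] by (auto simp: P C mem_Times_iff algebra_simps)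
  have x: "fst r + x \<in> I" "fst r + x + 1 \<notin> I"
    using bisect_boundary[of "\<lambda>e. in_cell n lab r (fst r + e, snd r)" 0 J] in_I out
    unfolding x_def[symmetric] by (auto simp: P C mem_Times_iff algebra_simps)
  have y: "snd r - y \<in> I'" "snd r - y - 1 \<notin> I'"
    using bisect_boundary[of "\<lambda>e. in_cell n lab r (fst r, snd r - e)" 0 J] in_I out
    unfolding y_def[symmetric] by (auto simp: P C mem_Times_iff algebra_simps)
  have z: "snd r + z \<in> I'" "snd r + z + 1 \<notin> I'"
    using bisect_boundary[of "\<lambda>e. in_cell n lab r (fst r, snd r + e)" 0 J] in_I out
    unfolding z_def[symmetric] by (auto simp: P C mem_Times_iff algebra_simps)
  have "0 \<le> w" "0 \<le> x" "0 \<le> y" "0 \<le> z"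
    unfolding w_def x_def y_def z_def by (rule bisect_ge)+
  moreover have "of_int \<bar>(fst r - w) - (fst r + x)\<bar> \<le> l" "of_int \<bar>(snd r - y) - (snd r + z)\<bar> \<le> l"
    using small[of "(fst r - w, snd r - y)" "(fst r + x, snd r + z)"] w x y z C by auto
  ultimately have "of_int (w + x) \<le> l" "of_int (y + z) \<le> l" by simp_all
  then show ?thesis
    unfolding passes_def Let_def w_def[symmetric] x_def[symmetric] y_def[symmetric] z_def[symmetric]
    using w x y z by (auto simp: P C corners_def rim_def Let_def)
qed

text \<open>\<open>box_excess\<close> applies to whichever box the searches returned;
  \<open>r\<close> lies in that box because the offsets are nonnegative.\<close>

lemma passes_imp_near:
  assumes "passes n lab J l r" and r: "r \<in> C" and conn: "grid_connected C" and conv: "grid_convex n C"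
    and P: "\<And>p. in_cell n lab r p \<longleftrightarrow> p \<in> C" and p: "p \<in> C"
  shows "sup_dist n p r \<le> (l + 2) / n"
proof -
  define w where "w = bisect (\<lambda>e. in_cell n lab r (fst r - e, snd r)) J 0"
  define x where "x = bisect (\<lambda>e. in_cell n lab r (fst r + e, snd r)) J 0"
  define y where "y = bisect (\<lambda>e. in_cell n lab r (fst r, snd r - e)) J 0"
  define z where "z = bisect (\<lambda>e. in_cell n lab r (fst r, snd r + e)) J 0"
  have nonneg: "0 \<le> w" "0 \<le> x" "0 \<le> y" "0 \<le> z"
    unfolding w_def x_def y_def z_def by (rule bisect_ge)+
  have small: "of_int (w + x) \<le> l" "of_int (y + z) \<le> l"
    and corners: "set (corners (fst r - w) (fst r + x) (snd r - y) (snd r + z)) \<subseteq> C"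
    and rim: "set (rim (fst r - w) (fst r + x) (snd r - y) (snd r + z)) \<inter> C = {}"
    using assms(1)
    unfolding passes_def Let_def w_def[symmetric] x_def[symmetric] y_def[symmetric] z_def[symmetric]
    by (simp_all only: P[symmetric] subset_iff disjoint_iff) blast+
  have "fst p \<in> {fst r - w - 2..fst r + x + 2} \<and> snd p \<in> {snd r - y - 2..snd r + z + 2}"
    using nonneg by (intro box_excess[OF conn conv corners rim r _ _ p]) auto
  then have "\<bar>fst p - fst r\<bar> \<le> w + x + 2" "\<bar>snd p - snd r\<bar> \<le> y + z + 2"
    using nonneg by auto
  then have "real_of_int (max \<bar>fst p - fst r\<bar> \<bar>snd p - snd r\<bar>) \<le> l + 2"
    using small by linarith
  then show ?thesis unfolding sup_dist_def by (intro divide_right_mono) auto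
qed

section \<open>Repeated probing and collecting samples\<close>

primrec probing :: "(('a \<Rightarrow> 'a algorithm) \<Rightarrow> 'a algorithm) \<Rightarrow> ('a \<Rightarrow> 'a algorithm \<Rightarrow> 'a algorithm)
    \<Rightarrow> nat \<Rightarrow> 'a algorithm \<Rightarrow> 'a algorithm" where
  "probing sample c 0 A = A"
| "probing sample c (Suc t) A = sample (\<lambda>r. c r (probing sample c t A))"

text \<open>A verdict other than \<open>v'\<close> can come only from \<open>A\<close>, after all
  \<open>t\<close> independent checks have succeeded.\<close>

lemma pmf_run_probing:
  assumes sample: "\<And>f. run lab \<mu> \<nu> (sample f) = bind_pmf \<kappa> (\<lambda>x. run lab \<mu> \<nu> (f (lab x)))"
    and c: "\<And>r A. run lab \<mu> \<nu> (c r A) = (if ok r then run lab \<mu> \<nu> A else return_pmf v')"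
    and v: "v \<noteq> v'"
  shows "pmf (run lab \<mu> \<nu> (probing sample c t A)) v
    = (1 - measure_pmf.prob \<kappa> {x. \<not> ok (lab x)}) ^ t * pmf (run lab \<mu> \<nu> A) v"
proof (induction t)
  case (Suc t)
  let ?q = "pmf (run lab \<mu> \<nu> (probing sample c t A)) v"
  have "pmf (run lab \<mu> \<nu> (probing sample c (Suc t) A)) v
      = measure_pmf.expectation \<kappa> (\<lambda>x. pmf (run lab \<mu> \<nu> (c (lab x) (probing sample c t A))) v)"
    by (simp add: sample pmf_bind)
  also have "(\<lambda>x. pmf (run lab \<mu> \<nu> (c (lab x) (probing sample c t A))) v)
      = (\<lambda>x. indicator {x. ok (lab x)} x * ?q)"
    using v by (auto simp: c indicator_def)
  also have "measure_pmf.expectation \<kappa> \<dots> = measure_pmf.prob \<kappa> {x. ok (lab x)} * ?q"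
    by simp
  also have "measure_pmf.prob \<kappa> {x. ok (lab x)} = 1 - measure_pmf.prob \<kappa> {x. \<not> ok (lab x)}"
    using measure_pmf.prob_compl[of "{x. \<not> ok (lab x)}" \<kappa>] by (simp add: Compl_eq set_diff_eq)
  finally show ?case by (simp add: Suc)
qed simp

lemma within_budget_probing:
  assumes sample: "\<And>f s q. (\<forall>y\<in>X. within_budget X (f y) s q) \<Longrightarrow> within_budget X (sample f) (Suc s) q"
    and c: "\<And>r A s q. within_budget X A s q \<Longrightarrow> within_budget X (c r A) s (b + q)"
    and "within_budget X A s q"
  shows "within_budget X (probing sample c t A) (t + s) (t * b + q)"
proof (induction t)
  case (Suc t)
  then show ?case using sample c by (simp add: add.assoc)
qed (simp add: assms)

primrec collect :: "(('a \<Rightarrow> 'a algorithm) \<Rightarrow> 'a algorithm) \<Rightarrow> nat \<Rightarrow> ('a list \<Rightarrow> 'a algorithm)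
    \<Rightarrow> 'a algorithm" where
  "collect sample 0 k = k []"
| "collect sample (Suc m) k = sample (\<lambda>x. collect sample m (\<lambda>xs. k (x # xs)))"

lemma run_collect:
  assumes sample: "\<And>f. run lab \<mu> \<nu> (sample f) = bind_pmf \<kappa> (\<lambda>x. run lab \<mu> \<nu> (f (lab x)))"
  shows "run lab \<mu> \<nu> (collect sample m k)
    = bind_pmf (replicate_pmf m (map_pmf lab \<kappa>)) (\<lambda>xs. run lab \<mu> \<nu> (k xs))"
  by (induction m arbitrary: k)
    (simp_all add: sample bind_return_pmf bind_map_pmf bind_assoc_pmf)

lemma within_budget_collect:
  assumes sample: "\<And>f s q. (\<forall>y\<in>X. within_budget X (f y) s q) \<Longrightarrow> within_budget X (sample f) (Suc s) q"
    and "\<And>xs. within_budget X (k xs) s q"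
  shows "within_budget X (collect sample m k) (m + s) q"
  using assms(2) by (induction m arbitrary: k) (auto intro: sample)

lemma map_replicate_pmf: "map_pmf (map f) (replicate_pmf m P) = replicate_pmf m (map_pmf f P)"
proof (induction m)
  case (Suc m)
  then show ?case by (simp add: map_bind_pmf bind_map_pmf Suc[symmetric])
qed simp

section \<open>Comparing the empirical distributions\<close>

definition compare_samples :: "nat \<Rightarrow> nat \<Rightarrow> nat \<Rightarrow> real \<Rightarrow> point algorithm" where
  "compare_samples n L m T = collect Sample_fst m (\<lambda>xs. collect Sample_snd m (\<lambda>ys.
     Output (if multiscale_dist L (empirical (map (finest_cell n L) xs))
                  (empirical (map (finest_cell n L) ys)) \<le> T
             then Accept else Reject)))"

lemma run_compare_samples:
  fixes n L :: nat
  defines "f \<equiv> \<lambda>lab x. finest_cell n L (lab x)"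
  shows "run lab \<mu> \<nu> (compare_samples n L m T)
    = map_pmf (\<lambda>(xs, ys). if multiscale_dist L (empirical xs) (empirical ys) \<le> T then Accept else Reject)
        (pair_pmf (replicate_pmf m (map_pmf (f lab) \<mu>)) (replicate_pmf m (map_pmf (f lab) \<nu>)))"
proof -
  have "replicate_pmf m (map_pmf (f lab) \<kappa>)
      = map_pmf (map (finest_cell n L)) (replicate_pmf m (map_pmf lab \<kappa>))" for \<kappa>
    by (simp add: map_replicate_pmf map_pmf_comp f_def)
  then show ?thesis
    unfolding compare_samples_def
    by (simp add: run_collect[where \<kappa> = \<mu>] run_collect[where \<kappa> = \<nu>] pair_pmf_def map_bind_pmf
        bind_map_pmf map_pmf_def[symmetric] map_pmf_comp)
qed

text \<open>Unless an empirical distribution deviates by \<open>T / 2\<close> or more, the statistic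
  differs from the true distance by less than \<open>T\<close>, so the threshold \<open>T\<close>
  separates 0 from values above \<open>2 * T\<close>. The two deviations have probability at most
  \<open>2 * L / (M * T)\<close> each.\<close>

lemma
  fixes n L M :: nat and T :: real
  assumes supp: "set_pmf \<mu> \<subseteq> grid n" "set_pmf \<nu> \<subseteq> grid n"
    and lab: "\<And>x. x \<in> grid n \<Longrightarrow> lab x \<in> grid n"
    and "0 < M" "0 < T"
  defines "P \<equiv> \<lambda>\<kappa>. map_pmf (\<lambda>x. finest_cell n L (lab x)) \<kappa>"
    and "out \<equiv> run lab \<mu> \<nu> (compare_samples n L (M\<^sup>2) T)"
  shows compare_samples_complete: "P \<mu> = P \<nu> \<Longrightarrow> pmf out Reject \<le> 4 * L / (M * T)"
    and compare_samples_sound: "2 * T < multiscale_dist L (P \<mu>) (P \<nu>) \<Longrightarrow> pmf out Accept \<le> 4 * L / (M * T)"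
    and compare_samples_no_cluster_reject: "pmf out Cluster_Reject = 0"
proof -
  let ?R = "\<lambda>\<kappa>. replicate_pmf (M\<^sup>2) (P \<kappa>)"
  let ?dev = "\<lambda>\<kappa> xs. multiscale_dist L (empirical xs) (P \<kappa>)"
  let ?stat = "\<lambda>z. multiscale_dist L (empirical (fst z)) (empirical (snd z))"
  let ?pair = "pair_pmf (?R \<mu>) (?R \<nu>)"
  have out: "out = map_pmf (\<lambda>z. if ?stat z \<le> T then Accept else Reject) ?pair"
    unfolding out_def run_compare_samples P_def by (simp add: case_prod_unfold)
  have cells: "set_pmf (P \<kappa>) \<subseteq> {0..<2 ^ L} \<times> {0..<2 ^ L}" if "set_pmf \<kappa> \<subseteq> grid n" for \<kappa>
    using that lab finest_cell_in_box[of _ n L] unfolding P_def set_map_pmf image_subset_iff by blast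
  have fin: "finite (set_pmf (P \<mu>))" "finite (set_pmf (P \<nu>))"
    using finite_subset[OF cells[OF supp(1)]] finite_subset[OF cells[OF supp(2)]] by auto
  let ?bad = "{z. T / 2 \<le> ?dev \<mu> (fst z)} \<union> {z. T / 2 \<le> ?dev \<nu> (snd z)}"
  have "measure_pmf.prob ?pair ?bad \<le> measure_pmf.prob ?pair {z. T / 2 \<le> ?dev \<mu> (fst z)}
      + measure_pmf.prob ?pair {z. T / 2 \<le> ?dev \<nu> (snd z)}"
    by (rule measure_Un_le) auto
  also have "measure_pmf.prob ?pair {z. T / 2 \<le> ?dev \<mu> (fst z)}
      = measure_pmf.prob (map_pmf fst ?pair) {xs. T / 2 \<le> ?dev \<mu> xs}"
    by (simp add: vimage_def)
  also have "\<dots> \<le> L / M / (T / 2)"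
    unfolding map_fst_pair_pmf using assms by (intro prob_multiscale_dist_empirical cells) auto
  also have "measure_pmf.prob ?pair {z. T / 2 \<le> ?dev \<nu> (snd z)}
      = measure_pmf.prob (map_pmf snd ?pair) {xs. T / 2 \<le> ?dev \<nu> xs}"
    by (simp add: vimage_def)
  also have "\<dots> \<le> L / M / (T / 2)"
    unfolding map_snd_pair_pmf using assms by (intro prob_multiscale_dist_empirical cells) auto
  finally have bad: "measure_pmf.prob ?pair ?bad \<le> 4 * L / (M * T)" by (simp add: mult.commute)
  have fin_emp: "finite (set_pmf (empirical (fst z)))" "finite (set_pmf (empirical (snd z)))"
    if "z \<in> set_pmf ?pair" for z
  proof -
    have "length (fst z) = M\<^sup>2" "length (snd z) = M\<^sup>2"
      using that by (auto simp: set_replicate_pmf)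
    then have "fst z \<noteq> []" "snd z \<noteq> []" using \<open>0 < M\<close> by auto
    then show "finite (set_pmf (empirical (fst z)))" "finite (set_pmf (empirical (snd z)))"
      by (simp_all add: set_pmf_empirical)
  qed
  have stat_le: "?stat z \<le> ?dev \<mu> (fst z) + multiscale_dist L (P \<mu>) (P \<nu>) + ?dev \<nu> (snd z)"
    and dist_le: "multiscale_dist L (P \<mu>) (P \<nu>) \<le> ?dev \<mu> (fst z) + ?stat z + ?dev \<nu> (snd z)"
    if "z \<in> set_pmf ?pair" for z
    using multiscale_dist_triangle[of "empirical (fst z)" "P \<mu>" "empirical (snd z)" L]
      multiscale_dist_triangle[of "P \<mu>" "P \<nu>" "empirical (snd z)" L]
      multiscale_dist_triangle[of "P \<mu>" "empirical (fst z)" "P \<nu>" L]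
      multiscale_dist_triangle[of "empirical (fst z)" "empirical (snd z)" "P \<nu>" L]
      fin fin_emp[OF that] multiscale_dist_commute[of L]
    by (smt (verit))+
  show "pmf out Reject \<le> 4 * L / (M * T)" if eq: "P \<mu> = P \<nu>"
  proof -
    have zero: "multiscale_dist L (P \<mu>) (P \<nu>) = 0"
      by (simp add: eq multiscale_dist_def l1_dist_def)
    have "pmf out Reject = measure_pmf.prob ?pair {z. \<not> ?stat z \<le> T}"
      unfolding out pmf_map by (rule arg_cong[where f = "measure_pmf.prob ?pair"]) (auto split: if_splits)
    also have "\<dots> \<le> measure_pmf.prob ?pair ?bad"
    proof (rule measure_pmf.finite_measure_mono_AE)
      show "AE z in ?pair. z \<in> {z. \<not> ?stat z \<le> T} \<longrightarrow> z \<in> ?bad"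
        using stat_le zero by (intro AE_pmfI) fastforce
    qed simp
    finally show ?thesis using bad by linarith
  qed
  show "pmf out Accept \<le> 4 * L / (M * T)" if far: "2 * T < multiscale_dist L (P \<mu>) (P \<nu>)"
  proof -
    have "pmf out Accept = measure_pmf.prob ?pair {z. ?stat z \<le> T}"
      unfolding out pmf_map by (rule arg_cong[where f = "measure_pmf.prob ?pair"]) (auto split: if_splits)
    also have "\<dots> \<le> measure_pmf.prob ?pair ?bad"
    proof (rule measure_pmf.finite_measure_mono_AE)
      show "AE z in ?pair. z \<in> {z. ?stat z \<le> T} \<longrightarrow> z \<in> ?bad"
        using dist_le far by (intro AE_pmfI) fastforce
    qed simp
    finally show ?thesis using bad by linarith
  qed
  show "pmf out Cluster_Reject = 0"
    by (auto simp: pmf_eq_0_set_pmf out)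
qed

lemma within_budget_compare_samples: "within_budget X (compare_samples n L m T) (m + m) 0"
proof -
  have "within_budget X (compare_samples n L m T) (m + (m + 0)) 0"
    unfolding compare_samples_def by (intro within_budget_collect) auto
  then show ?thesis by simp
qed

section \<open>Correctness of the tester\<close>

lemma cell_of_eq:
  assumes "partition_on X \<Gamma>" "C \<in> \<Gamma>" "x \<in> C"
  shows "cell_of \<Gamma> x = C"
  unfolding cell_of_def using assms partition_onD2[OF assms(1)]
  by (intro the_equality) (auto simp: disjoint_def)

lemma
  assumes "(\<Gamma>, rep) \<in> clusterings X" "x \<in> X"
  shows cell_of_in_clustering: "cell_of \<Gamma> x \<in> \<Gamma>"
    and mem_cell_of: "x \<in> cell_of \<Gamma> x"
    and label_mem_cell_of: "label (\<Gamma>, rep) x \<in> cell_of \<Gamma> x"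
    and cell_of_subset: "cell_of \<Gamma> x \<subseteq> X"
proof -
  have part: "partition_on X \<Gamma>" and rep: "\<forall>C\<in>\<Gamma>. rep C \<in> C"
    using assms by (auto simp: clusterings_def)
  obtain C where C: "C \<in> \<Gamma>" "x \<in> C"
    using assms(2) partition_onD1[OF part] by auto
  have "cell_of \<Gamma> x = C" by (rule cell_of_eq[OF part C])
  then show "cell_of \<Gamma> x \<in> \<Gamma>" "x \<in> cell_of \<Gamma> x" "label (\<Gamma>, rep) x \<in> cell_of \<Gamma> x" "cell_of \<Gamma> x \<subseteq> X"
    using C rep partition_onD1[OF part] by (auto simp: label_def)
qed

text \<open>A label lies in the cell that it represents, so applying \<open>cell_of\<close> to it
  recovers the cell.\<close>

lemma label_eq_iff:
  assumes \<Gamma>: "(\<Gamma>, rep) \<in> clusterings X" and x: "x \<in> X"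
  shows "y \<in> X \<and> label (\<Gamma>, rep) y = label (\<Gamma>, rep) x \<longleftrightarrow> y \<in> cell_of \<Gamma> x"
proof -
  have part: "partition_on X \<Gamma>" using \<Gamma> by (simp add: clusterings_def)
  show ?thesis
  proof
    assume y: "y \<in> X \<and> label (\<Gamma>, rep) y = label (\<Gamma>, rep) x"
    have "cell_of \<Gamma> (label (\<Gamma>, rep) z) = cell_of \<Gamma> z" if "z \<in> X" for z
      using that \<Gamma> part by (intro cell_of_eq cell_of_in_clustering label_mem_cell_of)
    then have "cell_of \<Gamma> y = cell_of \<Gamma> x" using x y by metis
    then show "y \<in> cell_of \<Gamma> x" using mem_cell_of[OF \<Gamma>, of y] y by simp
  next
    assume y: "y \<in> cell_of \<Gamma> x"
    then have "cell_of \<Gamma> y = cell_of \<Gamma> x"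
      using \<Gamma> x part by (intro cell_of_eq cell_of_in_clustering)
    then show "y \<in> X \<and> label (\<Gamma>, rep) y = label (\<Gamma>, rep) x"
      using y cell_of_subset[OF \<Gamma> x] by (auto simp: label_def)
  qed
qed

definition tester :: "nat \<Rightarrow> nat \<Rightarrow> nat \<Rightarrow> nat \<Rightarrow> nat \<Rightarrow> real \<Rightarrow> real \<Rightarrow> point algorithm" where
  "tester n J L M t l T =
     (let c = \<lambda>r A. check_cell n J l r A (Output Cluster_Reject)
      in probing Sample_fst c t (probing Sample_snd c t (compare_samples n L (M\<^sup>2) T)))"

lemma within_budget_tester:
  "within_budget (grid n) (tester n J L M t l T) (2 * M\<^sup>2 + 2 * t) (2 * t * (4 * J + 16))"
proof -
  have "within_budget (grid n) (tester n J L M t l T) (t + (t + (M\<^sup>2 + M\<^sup>2)))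
      (t * (4 * J + 16) + (t * (4 * J + 16) + 0))"
    unfolding tester_def Let_def
    by (intro within_budget_probing within_budget_compare_samples within_budget_check_cell) auto
  then show ?thesis by (rule within_budget_mono) (auto simp: algebra_simps)
qed

lemma UNIV_verdict: "UNIV = {Accept, Reject, Cluster_Reject}"
  using verdict.exhaust by auto

lemma pmf_verdict_sum: "pmf V Accept + pmf V Reject + pmf V Cluster_Reject = 1"
proof -
  have "sum (pmf V) {Accept, Reject, Cluster_Reject} = 1"
    by (rule sum_pmf_eq_1) (simp, simp flip: UNIV_verdict)
  then show ?thesis by simp
qed

text \<open>In this form each guarantee of a tester is an upper bound of 1/6 on the probability of a
  single verdict.\<close>

lemma prob_verdict:
  "measure_pmf.prob V {Cluster_Reject} = pmf V Cluster_Reject"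
  "measure_pmf.prob V {Accept, Cluster_Reject} = 1 - pmf V Reject"
  "measure_pmf.prob V {Reject, Cluster_Reject} = 1 - pmf V Accept"
  using pmf_verdict_sum[of V] by (simp_all add: measure_measure_pmf_finite measure_pmf_single)

lemma power_one_minus_le:
  fixes b :: real
  assumes "b \<le> 1" "2 \<le> real t * b"
  shows "(1 - b) ^ t \<le> 1 / 6"
proof -
  have "1 - b \<le> exp (- b)" using exp_ge_add_one_self[of "- b"] by simp
  then have "(1 - b) ^ t \<le> exp (- b) ^ t" using assms by (intro power_mono) auto
  also have "\<dots> = exp (- (real t * b))" by (simp flip: exp_of_nat_mult)
  also have "\<dots> \<le> exp (- 2)" using assms by simp
  also have "\<dots> \<le> 1 / 6"
  proof -
    \<comment> \<open>The square of 5/2 is 25/4, just above 6.\<close>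
    have "(5 / 2 :: real) * (5 / 2) \<le> exp 1 * exp 1"
      using exp_lower_Taylor_quadratic[of 1] by (intro mult_mono) auto
    also have "\<dots> = (exp 2 :: real)" by (simp flip: exp_add)
    finally show ?thesis by (simp add: exp_minus field_simps)
  qed
  finally show ?thesis .
qed

text \<open>The value 81/32 makes \<open>81 / (384 * (81 / 32))\<close> equal to 1/12, half of the
  error allowed for \<open>Cluster_Reject\<close>; each distribution gets one half.\<close>

lemma ln_24_ge: "81 / 32 \<le> ln (24 :: real)"
proof -
  have "81 / 32 \<le> 4 * ln (2 :: real)" using ln2_ge_two_thirds by simp
  also have "\<dots> = ln (2 ^ 4)" by (subst ln_realpow) auto
  also have "\<dots> \<le> ln 24" by simp
  finally show ?thesis .
qed

lemma tester_correct:
  fixes n J L M t :: nat and p \<epsilon> \<Delta> :: real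
  assumes n: "1 \<le> n" and p: "1 \<le> p" and \<Delta>: "0 < \<Delta>" "\<Delta> < \<epsilon> - 8 / n" "\<Delta> \<le> \<epsilon> / 8"
    and J: "n < 2 ^ J" and t: "80 \<le> t * \<epsilon>" "t * \<epsilon> \<le> 81"
    and L: "2 / 2 ^ L \<le> \<epsilon> / 160" and M: "0 < M" "4 * L / (M * (\<epsilon> / 640)) \<le> 1 / 6"
  shows "diameter_guarded_tester (grid n) (grid_dist p n) (CC n) (boxes n) \<Delta> \<epsilon>
    (tester n J L M t (2 * \<Delta> * n) (\<epsilon> / 640))"
  unfolding diameter_guarded_tester_def Let_def
proof (intro allI impI)
  fix \<Gamma> rep \<mu> \<nu>
  assume asm: "(\<Gamma>, rep) \<in> CC n \<and> set_pmf \<mu> \<subseteq> grid n \<and> set_pmf \<nu> \<subseteq> grid n"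
  then have supp: "set_pmf \<mu> \<subseteq> grid n" "set_pmf \<nu> \<subseteq> grid n" and \<Gamma>: "(\<Gamma>, rep) \<in> clusterings (grid n)"
    and CC: "\<And>C. C \<in> \<Gamma> \<Longrightarrow> grid_connected C \<and> grid_convex n C"
    by (auto simp: CC_def)
  define lab where "lab = label (\<Gamma>, rep)"
  define l where "l = 2 * \<Delta> * n"
  define T where "T = \<epsilon> / 640"
  define ok where "ok = passes n lab J l"
  define bad where "bad \<kappa> = measure_pmf.prob \<kappa> {x. \<not> ok (lab x)}" for \<kappa>
  define stat where "stat = run lab \<mu> \<nu> (compare_samples n L (M\<^sup>2) T)"
  define out where "out = run lab \<mu> \<nu> (tester n J L M t l T)"
  have \<epsilon>: "0 < \<epsilon>" and T: "0 < T" using \<Delta> by (auto simp: T_def)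
  have bad: "0 \<le> bad \<kappa>" "bad \<kappa> \<le> 1" for \<kappa> by (auto simp: bad_def)
  have in_cell: "in_cell n lab (lab x) y \<longleftrightarrow> y \<in> cell_of \<Gamma> x" if "x \<in> grid n" for x y
    using label_eq_iff[OF \<Gamma> that] by (simp add: in_cell_def lab_def)
  have lab_grid: "lab x \<in> grid n" if "x \<in> grid n" for x
    using label_mem_cell_of[OF \<Gamma> that] cell_of_subset[OF \<Gamma> that] by (auto simp: lab_def)
  \<comment> \<open>The comparison is reached only if all probes of both distributions succeed, and
    only probes produce \<open>Cluster_Reject\<close>.\<close>
  have out: "pmf out v = (1 - bad \<mu>) ^ t * ((1 - bad \<nu>) ^ t * pmf stat v)" if "v \<noteq> Cluster_Reject" for v
  proof -
    let ?c = "\<lambda>r A. check_cell n J l r A (Output Cluster_Reject)"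
    have "pmf (run lab \<mu> \<nu> (probing sample ?c t A)) v = (1 - bad \<kappa>) ^ t * pmf (run lab \<mu> \<nu> A) v"
      if "\<And>f. run lab \<mu> \<nu> (sample f) = bind_pmf \<kappa> (\<lambda>x. run lab \<mu> \<nu> (f (lab x)))" for sample \<kappa> A
      unfolding bad_def using \<open>v \<noteq> Cluster_Reject\<close>
      by (intro pmf_run_probing[OF that]) (auto simp: ok_def run_check_cell)
    then show ?thesis by (simp add: out_def tester_def stat_def Let_def)
  qed
  have stat_sum: "pmf stat Accept + pmf stat Reject = 1"
    using pmf_verdict_sum[of stat] compare_samples_no_cluster_reject[where lab = lab, OF supp lab_grid M(1) T]
    by (simp add: stat_def)
  have factor: "0 \<le> (1 - bad \<kappa>) ^ t" "(1 - bad \<kappa>) ^ t \<le> 1" for \<kappa>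
    using bad[of \<kappa>] by (auto intro: power_le_one)
  have out_le: "pmf out v \<le> (1 - bad \<mu>) ^ t" "pmf out v \<le> (1 - bad \<nu>) ^ t" "pmf out v \<le> pmf stat v"
    if "v \<noteq> Cluster_Reject" for v
  proof -
    have stat: "0 \<le> pmf stat v" "pmf stat v \<le> 1" by (auto intro: pmf_le_1)
    show "pmf out v \<le> (1 - bad \<mu>) ^ t" "pmf out v \<le> (1 - bad \<nu>) ^ t" "pmf out v \<le> pmf stat v"
      unfolding out[OF that] using factor[of \<mu>] factor[of \<nu>] stat
      by (auto simp: mult_le_one mult_left_le mult_left_le_one_le
          intro: order_trans[OF mult_left_le_one_le])
  qed
  have "pmf out Cluster_Reject \<le> 1 / 6"
    if "(\<Gamma>, rep) \<in> boxes n"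
      "measure_pmf.prob \<mu> {x. diam (grid_dist p n) (cell_of \<Gamma> x) > \<Delta>} \<le> guard_const * \<epsilon>"
      "measure_pmf.prob \<nu> {x. diam (grid_dist p n) (cell_of \<Gamma> x) > \<Delta>} \<le> guard_const * \<epsilon>"
  proof -
    have "ok (lab x)" if "x \<in> grid n" "diam (grid_dist p n) (cell_of \<Gamma> x) \<le> \<Delta>" for x
      unfolding ok_def
    proof (rule passes_box[OF _ _ in_cell[OF that(1)] J])
      let ?C = "cell_of \<Gamma> x"
      show "lab x \<in> ?C" using label_mem_cell_of[OF \<Gamma> that(1)] by (simp add: lab_def)
      show "grid_box n ?C"
        using \<open>(\<Gamma>, rep) \<in> boxes n\<close> cell_of_in_clustering[OF \<Gamma> that(1)] by (auto simp: boxes_def)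
      fix y z assume yz: "y \<in> ?C" "z \<in> ?C"
      have "finite ?C" using cell_of_subset[OF \<Gamma> that(1)] finite_grid by (rule finite_subset)
      then have "grid_dist p n y z \<le> \<Delta>"
        using dist_le_diam[OF _ yz, of "grid_dist p n"] that(2) by linarith
      then have "sup_dist n y z \<le> 2 * \<Delta>" using grid_dist_bounds(3)[OF p n, of y z] by linarith
      then have "real_of_int (max \<bar>fst y - fst z\<bar> \<bar>snd y - snd z\<bar>) \<le> l"
        using n by (simp add: sup_dist_def l_def field_simps)
      then show "of_int \<bar>fst y - fst z\<bar> \<le> l \<and> of_int \<bar>snd y - snd z\<bar> \<le> l" by linarith
    qed
    then have "bad \<kappa> \<le> measure_pmf.prob \<kappa> {x. diam (grid_dist p n) (cell_of \<Gamma> x) > \<Delta>}"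
      if "set_pmf \<kappa> \<subseteq> grid n" for \<kappa>
      unfolding bad_def using that
      by (intro measure_pmf.finite_measure_mono_AE AE_pmfI) (force simp: not_less)+
    then have small: "bad \<mu> \<le> guard_const * \<epsilon>" "bad \<nu> \<le> guard_const * \<epsilon>"
      using supp that by (meson order_trans)+
    have bernoulli: "1 - t * (guard_const * \<epsilon>) \<le> (1 - bad \<kappa>) ^ t" if "bad \<kappa> \<le> guard_const * \<epsilon>" for \<kappa>
    proof -
      have "1 - t * (guard_const * \<epsilon>) \<le> 1 - t * bad \<kappa>" using that by (simp add: mult_left_mono)
      also have "\<dots> \<le> (1 - bad \<kappa>) ^ t"
        using Bernoulli_inequality[of "- bad \<kappa>" t] bad[of \<kappa>] by simp
      finally show ?thesis .
    qed
    have "t * (guard_const * \<epsilon>) = (t * \<epsilon>) / (384 * ln 24)" by (simp add: guard_const_def)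
    also have "\<dots> \<le> 81 / (384 * (81 / 32))"
      using t ln_24_ge by (intro frac_le mult_left_mono) auto
    finally have guard: "t * (guard_const * \<epsilon>) \<le> 1 / 12" by simp
    have "pmf out Accept + pmf out Reject = (1 - bad \<mu>) ^ t * (1 - bad \<nu>) ^ t * (pmf stat Accept + pmf stat Reject)"
      by (simp add: out algebra_simps)
    then have "pmf out Cluster_Reject = 1 - (1 - bad \<mu>) ^ t * (1 - bad \<nu>) ^ t"
      using pmf_verdict_sum[of out] stat_sum by simp
    \<comment> \<open>Expanded, this is the union bound
      \<open>1 - x * y \<le> (1 - x) + (1 - y)\<close> for the two groups of probes; each term is at
      most 1/12.\<close>
    moreover have "0 \<le> (1 - (1 - bad \<mu>) ^ t) * (1 - (1 - bad \<nu>) ^ t)"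
      using factor by (intro mult_nonneg_nonneg) auto
    ultimately show ?thesis
      using bernoulli[OF small(1)] bernoulli[OF small(2)] guard by (simp add: algebra_simps)
  qed
  moreover have "pmf out Reject \<le> 1 / 6" if "\<mu> = \<nu>"
    using out_le(3)[of Reject] compare_samples_complete[where lab = lab and L = L, OF supp lab_grid M(1) T] that M(2)
    by (simp add: stat_def T_def)
  moreover have "pmf out Accept \<le> 1 / 6" if far: "\<epsilon> < emd (grid_dist p n) \<mu> \<nu>"
  \<comment> \<open>At least \<open>80 / \<epsilon>\<close> probes meet more than 2 bad cells on
    average above this threshold, and \<open>exp (- 2)\<close> is below 1/6.\<close>
  proof (cases "\<epsilon> / 40 < bad \<mu> \<or> \<epsilon> / 40 < bad \<nu>")
    case True
    have detect: "(1 - bad \<kappa>) ^ t \<le> 1 / 6" if "\<epsilon> / 40 < bad \<kappa>" for \<kappa>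
    proof (rule power_one_minus_le)
      have "2 \<le> t * (\<epsilon> / 40)" using t by simp
      also have "\<dots> \<le> t * bad \<kappa>" using that by (intro mult_left_mono) auto
      finally show "2 \<le> t * bad \<kappa>" .
    qed (rule bad)
    show ?thesis using True detect out_le(1,2)[of Accept] by force
  next
    case False
    \<comment> \<open>Points in cells that fail the check are charged 1, which bounds every distance
      in the grid.\<close>
    have near: "sup_dist n x (lab x) \<le> 2 * \<Delta> + 2 / n + indicator {x. \<not> ok (lab x)} x"
      if x: "x \<in> grid n" for x
    proof (cases "ok (lab x)")
      case True
      have "sup_dist n x (lab x) \<le> (l + 2) / n"
        using True label_mem_cell_of[OF \<Gamma> x] CC[OF cell_of_in_clustering[OF \<Gamma> x]]
          in_cell[OF x] mem_cell_of[OF \<Gamma> x] unfolding ok_def lab_def[symmetric]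
        by (intro passes_imp_near) auto
      also have "\<dots> = 2 * \<Delta> + 2 / n" using n by (simp add: l_def field_simps)
      finally show ?thesis using True by simp
    next
      case False
      then show ?thesis using sup_dist_le_1[OF x lab_grid[OF x]] \<Delta>(1) by (simp add: add_increasing)
    qed
    have mean: "measure_pmf.expectation \<kappa> (\<lambda>x. sup_dist n x (lab x)) \<le> 2 * \<Delta> + 2 / n + bad \<kappa>"
      if "set_pmf \<kappa> \<subseteq> grid n" for \<kappa>
    proof -
      note int = integrable_measure_pmf_finite[OF finite_subset[OF that finite_grid]]
      have "measure_pmf.expectation \<kappa> (\<lambda>x. sup_dist n x (lab x))
          \<le> measure_pmf.expectation \<kappa> (\<lambda>x. 2 * \<Delta> + 2 / n + indicator {x. \<not> ok (lab x)} x)"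
        using near that by (intro integral_mono_AE int AE_pmfI) blast
      also have "\<dots> = 2 * \<Delta> + 2 / n + bad \<kappa>"
        by (subst Bochner_Integration.integral_add) (auto simp: int bad_def)
      finally show ?thesis .
    qed
    define W where "W = multiscale_dist L (map_pmf (\<lambda>x. finest_cell n L (lab x)) \<mu>)
      (map_pmf (\<lambda>x. finest_cell n L (lab x)) \<nu>)"
    have "emd (grid_dist p n) \<mu> \<nu> \<le> measure_pmf.expectation \<mu> (\<lambda>x. sup_dist n x (lab x))
        + measure_pmf.expectation \<nu> (\<lambda>x. sup_dist n x (lab x)) + 2 / 2 ^ L + 2 * W"
      unfolding W_def using grid_dist_bounds[OF p n] supp lab_grid by (intro emd_le_multiscale n) auto
    then have "\<epsilon> < 4 * \<Delta> + 4 / n + \<epsilon> / 20 + \<epsilon> / 160 + 2 * W"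
      using far mean[OF supp(1)] mean[OF supp(2)] False L by simp
    \<comment> \<open>From \<open>8 / n < \<epsilon> - \<Delta>\<close> and
      \<open>\<Delta> \<le> \<epsilon> / 8\<close> follows
      \<open>4 * \<Delta> + 4 / n < 15 / 16 * \<epsilon>\<close>. With
      \<open>\<epsilon> / 20 + \<epsilon> / 160\<close> this leaves \<open>2 * W\<close> more than
      \<open>\<epsilon> / 160\<close>, which is \<open>4 * T\<close>.\<close>
    then have "2 * T < W" using \<Delta> by (simp add: T_def)
    then have "pmf stat Accept \<le> 4 * L / (M * T)"
      unfolding stat_def W_def by (intro compare_samples_sound[where lab = lab, OF supp lab_grid M(1) T]) auto
    also have "\<dots> \<le> 1 / 6" using M(2) by (simp add: T_def)
    finally show ?thesis using out_le(3)[of Accept] by simp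
  qed
  ultimately show "((\<Gamma>, rep) \<in> boxes n
        \<and> measure_pmf.prob \<mu> {x. diam (grid_dist p n) (cell_of \<Gamma> x) > \<Delta>} \<le> guard_const * \<epsilon>
        \<and> measure_pmf.prob \<nu> {x. diam (grid_dist p n) (cell_of \<Gamma> x) > \<Delta>} \<le> guard_const * \<epsilon>
      \<longrightarrow> measure_pmf.prob (run (label (\<Gamma>, rep)) \<mu> \<nu> (tester n J L M t (2 * \<Delta> * n) (\<epsilon> / 640))) {Cluster_Reject} \<le> 1 / 6) \<and>
    (\<mu> = \<nu> \<longrightarrow> 5 / 6 \<le> measure_pmf.prob (run (label (\<Gamma>, rep)) \<mu> \<nu> (tester n J L M t (2 * \<Delta> * n) (\<epsilon> / 640))) {Accept, Cluster_Reject}) \<and>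
    (\<epsilon> < emd (grid_dist p n) \<mu> \<nu> \<longrightarrow>
      5 / 6 \<le> measure_pmf.prob (run (label (\<Gamma>, rep)) \<mu> \<nu> (tester n J L M t (2 * \<Delta> * n) (\<epsilon> / 640))) {Reject, Cluster_Reject})"
    unfolding prob_verdict lab_def[symmetric] l_def[symmetric] T_def[symmetric] out_def[symmetric] by auto
qed

text \<open>All distances in the grid are at most 1, so for these \<open>\<epsilon>\<close> no pair
  of distributions is far.\<close>

lemma accept_correct:
  assumes "1 \<le> n" "1 \<le> p" "1 \<le> \<epsilon>"
  shows "diameter_guarded_tester (grid n) (grid_dist p n) \<U> \<G> \<Delta> \<epsilon> (Output Accept)"
proof -
  have "emd (grid_dist p n) \<mu> \<nu> \<le> \<epsilon>" if supp: "set_pmf \<mu> \<subseteq> grid n" "set_pmf \<nu> \<subseteq> grid n" for \<mu> \<nu>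
  proof -
    let ?\<pi> = "pair_pmf \<mu> \<nu>"
    note bounds = grid_dist_bounds[OF assms(2,1)]
    have "emd (grid_dist p n) \<mu> \<nu> \<le> measure_pmf.expectation ?\<pi> (\<lambda>(x, y). grid_dist p n x y)"
      by (intro emd_le_coupling pair_pmf_in_couplings bounds)
    also have "\<dots> \<le> measure_pmf.expectation ?\<pi> (\<lambda>_. 1)"
    proof (intro integral_mono_AE integrable_measure_pmf_finite AE_pmfI)
      fix z assume "z \<in> set_pmf ?\<pi>"
      then have "sup_dist n (fst z) (snd z) \<le> 1" using supp by (intro sup_dist_le_1) auto
      then show "(case z of (x, y) \<Rightarrow> grid_dist p n x y) \<le> 1"
        using bounds(2)[of "fst z" "snd z"] by (simp add: case_prod_unfold)
    qed (use finite_subset[OF supp(1) finite_grid] finite_subset[OF supp(2) finite_grid] in auto)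
    finally show ?thesis using assms(3) by simp
  qed
  then show ?thesis
    unfolding diameter_guarded_tester_def Let_def prob_verdict by (force simp: not_less[symmetric])
qed

section \<open>Choice of the parameters\<close>

definition probe_count :: "real \<Rightarrow> nat" where
  "probe_count \<epsilon> = nat \<lceil>80 / \<epsilon>\<rceil>"

text \<open>The aim is \<open>2 ^ L \<ge> 320 / \<epsilon>\<close>. With
  \<open>z = 2 + 1 / \<epsilon> \<ge> 3\<close> one has \<open>320 * z \<le> z ^ 7\<close>, and
  \<open>ln 2 \<ge> 2 / 3\<close> turns the exponent 7 into 11, as \<open>11 * 2 / 3 > 7\<close>.
  Being generous costs only constants, since the sample size depends on the number of levels and not
  on the number of cells.\<close>

definition level_count :: "real \<Rightarrow> nat" where
  "level_count \<epsilon> = nat \<lceil>11 * ln (2 + 1 / \<epsilon>)\<rceil>"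

text \<open>The bound \<open>4 * L / (M * T) \<le> 1 / 6\<close> of \<open>tester_correct\<close> with \<open>T = \<epsilon> / 640\<close> asks for
  \<open>M \<ge> 24 * 640 * L / \<epsilon>\<close>.\<close>

definition sample_root :: "real \<Rightarrow> nat" where
  "sample_root \<epsilon> = nat \<lceil>15360 * real (level_count \<epsilon>) / \<epsilon>\<rceil>"

text \<open>As \<open>ln 2 \<ge> 2 / 3\<close>, the factor 2 more than converts \<open>ln\<close> to
  base 2; the final 1 makes \<open>n < 2 ^ bit_count n\<close> strict.\<close>

definition bit_count :: "nat \<Rightarrow> nat" where
  "bit_count n = nat \<lceil>2 * ln (real n)\<rceil> + 1"

lemma probe_count_bounds:
  fixes \<epsilon> :: real
  assumes "0 < \<epsilon>" "\<epsilon> < 1"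
  shows "80 \<le> probe_count \<epsilon> * \<epsilon>" "probe_count \<epsilon> * \<epsilon> \<le> 81"
proof -
  have "0 \<le> 80 / \<epsilon>" using assms by simp
  then have "80 / \<epsilon> \<le> probe_count \<epsilon>" "probe_count \<epsilon> \<le> 80 / \<epsilon> + 1"
    unfolding probe_count_def by linarith+
  then show "80 \<le> probe_count \<epsilon> * \<epsilon>" "probe_count \<epsilon> * \<epsilon> \<le> 81"
    using assms by (auto simp: field_simps)
qed

lemma ln_ge_1:
  fixes \<epsilon> :: real
  assumes "0 < \<epsilon>" "\<epsilon> < 1"
  shows "1 \<le> ln (2 + 1 / \<epsilon>)"
proof -
  have "(3 :: real) \<le> 2 + 1 / \<epsilon>" using assms by simp
  then have "exp 1 \<le> 2 + 1 / \<epsilon>" using exp_le by linarith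
  then show ?thesis using assms by (subst ln_ge_iff) (auto intro: add_pos_pos)
qed

lemma level_count_bounds:
  fixes \<epsilon> :: real
  assumes "0 < \<epsilon>" "\<epsilon> < 1"
  shows "1 \<le> level_count \<epsilon>" "level_count \<epsilon> \<le> 12 * ln (2 + 1 / \<epsilon>)" "2 / 2 ^ level_count \<epsilon> \<le> \<epsilon> / 160"
proof -
  define z where "z = 2 + 1 / \<epsilon>"
  have z: "3 \<le> z" using assms by (simp add: z_def)
  have ln: "1 \<le> ln z" unfolding z_def by (rule ln_ge_1[OF assms])
  have L: "11 * ln z \<le> level_count \<epsilon>" "level_count \<epsilon> \<le> 11 * ln z + 1"
    using ln unfolding level_count_def z_def by linarith+
  then show "1 \<le> level_count \<epsilon>" "level_count \<epsilon> \<le> 12 * ln (2 + 1 / \<epsilon>)"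
    using ln unfolding z_def by linarith+
  have "320 * z \<le> 3 ^ 6 * z" using z by simp
  also have "\<dots> \<le> z ^ 6 * z" using z by (intro mult_right_mono power_mono) auto
  also have "\<dots> = exp (7 * ln z)"
    using z exp_of_nat_mult[of 7 "ln z"] by (simp add: power_Suc2[symmetric])
  also have "\<dots> \<le> exp (level_count \<epsilon> * ln 2)"
  proof -
    have "7 * ln z \<le> (11 * ln z) * (2 / 3)" using ln by simp
    also have "\<dots> \<le> level_count \<epsilon> * ln 2"
      using L ln ln2_ge_two_thirds by (intro mult_mono) auto
    finally show ?thesis by simp
  qed
  also have "\<dots> = 2 ^ level_count \<epsilon>" by (simp add: exp_of_nat_mult)
  finally have "320 * z \<le> 2 ^ level_count \<epsilon>" .
  moreover have "320 / \<epsilon> \<le> 320 * z" by (simp add: z_def)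
  ultimately have "320 / \<epsilon> \<le> 2 ^ level_count \<epsilon>" by linarith
  then show "2 / 2 ^ level_count \<epsilon> \<le> \<epsilon> / 160" using assms by (simp add: field_simps)
qed

lemma sample_root_bounds:
  fixes \<epsilon> :: real
  assumes "0 < \<epsilon>" "\<epsilon> < 1"
  shows "0 < sample_root \<epsilon>" "4 * level_count \<epsilon> / (sample_root \<epsilon> * (\<epsilon> / 640)) \<le> 1 / 6"
    "sample_root \<epsilon> \<le> 184332 * (1 / \<epsilon>) * ln (2 + 1 / \<epsilon>)"
proof -
  define L where "L = real (level_count \<epsilon>)"
  note level = level_count_bounds[OF assms]
  have L: "1 \<le> L" "L \<le> 12 * ln (2 + 1 / \<epsilon>)" using level by (auto simp: L_def)
  have pos: "0 < 15360 * L / \<epsilon>" using L assms by simp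
  then have M: "15360 * L / \<epsilon> \<le> sample_root \<epsilon>" "sample_root \<epsilon> \<le> 15360 * L / \<epsilon> + 1"
    unfolding sample_root_def L_def by linarith+
  show "0 < sample_root \<epsilon>" using M pos by linarith
  then show "4 * level_count \<epsilon> / (sample_root \<epsilon> * (\<epsilon> / 640)) \<le> 1 / 6"
    using M(1) assms unfolding L_def by (simp add: field_simps)
  \<comment> \<open>This absorbs the rounding and turns 15360 into 15361; with the 12 of
    \<open>level_count_bounds\<close> the product is 184332.\<close>
  have "1 \<le> L / \<epsilon>" using L assms by simp
  then have "sample_root \<epsilon> \<le> 15361 * (L / \<epsilon>)" using M(2) by simp
  also have "\<dots> \<le> 15361 * (12 * ln (2 + 1 / \<epsilon>) / \<epsilon>)"
    using L assms by (intro mult_left_mono divide_right_mono) auto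
  finally show "sample_root \<epsilon> \<le> 184332 * (1 / \<epsilon>) * ln (2 + 1 / \<epsilon>)" by simp
qed

lemma bit_count_bounds:
  assumes "2 \<le> n"
  shows "n < 2 ^ bit_count n" "real (4 * bit_count n + 16) \<le> 50 * ln (real n)"
proof -
  have ln2: "2 / 3 \<le> ln (real n)"
  proof -
    have "ln 2 \<le> ln (real n)" using assms by (subst ln_le_cancel_iff) auto
    then show ?thesis using ln2_ge_two_thirds by linarith
  qed
  define j where "j = nat \<lceil>2 * ln (real n)\<rceil>"
  have j: "2 * ln (real n) \<le> j" "j \<le> 2 * ln (real n) + 1" using ln2 unfolding j_def by linarith+
  \<comment> \<open>The left side is at most \<open>8 * ln n + 24\<close>, and
    \<open>24 \<le> 36 * ln n\<close> because \<open>ln n \<ge> 2 / 3\<close>.\<close>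
  then show "real (4 * bit_count n + 16) \<le> 50 * ln (real n)"
    using ln2 by (simp add: bit_count_def j_def[symmetric])
  have "ln (real n) \<le> (2 * ln (real n)) * (2 / 3)" using ln2 by simp
  also have "\<dots> \<le> j * ln 2" using j ln2 ln2_ge_two_thirds by (intro mult_mono) auto
  finally have "exp (ln (real n)) \<le> exp (j * ln 2)" by simp
  then have "real n \<le> 2 ^ j" using assms by (simp add: exp_of_nat_mult)
  also have "\<dots> < real (2 ^ bit_count n)" by (simp add: bit_count_def j_def)
  finally show "n < 2 ^ bit_count n" by (simp only: of_nat_less_iff)
qed

theorem theorem3p19:
  "\<exists>(m :: real \<Rightarrow> nat) (q :: real \<Rightarrow> nat \<Rightarrow> nat) (K :: real) (k :: nat).
     (\<forall>\<epsilon>>0. real (m \<epsilon>) \<le> K * (1 / \<epsilon>)\<^sup>2 * ln (2 + 1 / \<epsilon>) ^ k) \<and>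
     (\<forall>\<epsilon>>0. \<forall>n\<ge>1. real (q \<epsilon> n) \<le> K * (1 / \<epsilon>) * ln (real n)) \<and>
     (\<forall>(n :: nat) (p :: real) (\<epsilon> :: real) (\<Delta> :: real).
        1 \<le> n \<and> 1 \<le> p \<and> 0 < \<Delta> \<and> \<Delta> < \<epsilon> - 8 / real n \<and> \<Delta> \<le> \<epsilon> / 8 \<longrightarrow>
        (\<exists>A :: point algorithm.
           diameter_guarded_tester (grid n) (grid_dist p n) (CC n) (boxes n) \<Delta> \<epsilon> A \<and>
           within_budget (grid n) A (m \<epsilon>) (q \<epsilon> n)))"
proof -
  \<comment> \<open>For \<open>\<epsilon> \<ge> 1\<close> the tester is
    \<open>Output Accept\<close>, which needs no calls. At \<open>n = 1\<close> the bound
    \<open>ln n = 0\<close> forces \<open>q\<close> to vanish; this does no harm, since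
    \<open>\<epsilon> < 1\<close> entails \<open>8 / n < 1\<close>.\<close>
  define m where "m \<epsilon> = (if \<epsilon> < 1 then 2 * (sample_root \<epsilon>)\<^sup>2 + 2 * probe_count \<epsilon> else 0)" for \<epsilon>
  define q where "q \<epsilon> n = (if \<epsilon> < 1 \<and> 2 \<le> n then 2 * probe_count \<epsilon> * (4 * bit_count n + 16) else 0)"
    for \<epsilon> n
  \<comment> \<open>The first summand comes from the squared bound on \<open>sample_root\<close>.
    The second is twice the 81 of \<open>probe_count\<close>, times the 50 of
    \<open>bit_count_bounds\<close>; it serves \<open>q\<close> and also covers the probes counted
    in \<open>m\<close>.\<close>
  define K :: real where "K = 2 * 184332\<^sup>2 + 162 * 50"
  have m_le: "real (m \<epsilon>) \<le> K * (1 / \<epsilon>)\<^sup>2 * ln (2 + 1 / \<epsilon>) ^ 2" if \<epsilon>: "0 < \<epsilon>" for \<epsilon>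
  proof (cases "\<epsilon> < 1")
    case True
    define u where "u = 1 / \<epsilon>"
    define l where "l = ln (2 + 1 / \<epsilon>)"
    have u: "1 \<le> u" using \<epsilon> True by (simp add: u_def)
    have l: "1 \<le> l" using ln_ge_1[OF \<epsilon> True] by (simp add: l_def)
    have "(real (sample_root \<epsilon>))\<^sup>2 \<le> (184332 * u * l)\<^sup>2"
      using sample_root_bounds(3)[OF \<epsilon> True] by (intro power_mono) (auto simp: u_def l_def)
    moreover have "real (probe_count \<epsilon>) \<le> 81 * u"
      using probe_count_bounds(2)[OF \<epsilon> True] \<epsilon> by (simp add: u_def field_simps)
    moreover have "u * 1 \<le> u\<^sup>2 * l\<^sup>2"
      using u l by (intro mult_mono) (auto simp: self_le_power)
    ultimately have "real (m \<epsilon>) \<le> K * (u\<^sup>2 * l\<^sup>2)"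
      using True by (simp add: m_def K_def power_mult_distrib)
    then show ?thesis by (simp add: u_def l_def mult.assoc)
  next
    case False
    then show ?thesis by (simp add: m_def K_def)
  qed
  have q_le: "real (q \<epsilon> n) \<le> K * (1 / \<epsilon>) * ln (real n)" if \<epsilon>: "0 < \<epsilon>" and n: "1 \<le> n" for \<epsilon> n
  proof (cases "\<epsilon> < 1 \<and> 2 \<le> n")
    case True
    have "real (probe_count \<epsilon>) \<le> 81 / \<epsilon>"
      using probe_count_bounds(2)[OF \<epsilon>] True \<epsilon> by (simp add: field_simps)
    then have "real (probe_count \<epsilon>) * real (4 * bit_count n + 16) \<le> 81 / \<epsilon> * (50 * ln (real n))"
      using bit_count_bounds(2)[of n] True \<epsilon> by (intro mult_mono) auto
    then have "real (q \<epsilon> n) \<le> (162 * 50) * (1 / \<epsilon> * ln (real n))"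
      using True by (simp add: q_def)
    also have "\<dots> \<le> K * (1 / \<epsilon> * ln (real n))"
      using n \<epsilon> by (intro mult_right_mono) (auto simp: K_def)
    finally show ?thesis by (simp add: mult.assoc)
  next
    case False
    then have "q \<epsilon> n = 0" by (simp only: q_def if_False)
    then show ?thesis using \<epsilon> n by (simp add: K_def)
  qed
  have testers: "\<exists>A. diameter_guarded_tester (grid n) (grid_dist p n) (CC n) (boxes n) \<Delta> \<epsilon> A \<and>
      within_budget (grid n) A (m \<epsilon>) (q \<epsilon> n)"
    if "1 \<le> n" "1 \<le> p" "0 < \<Delta>" "\<Delta> < \<epsilon> - 8 / real n" "\<Delta> \<le> \<epsilon> / 8" for n p \<epsilon> \<Delta>
  proof (cases "\<epsilon> < 1")
    case True
    have \<epsilon>: "0 < \<epsilon>" using that by linarith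
    have "8 / real n < 1" using that True by linarith
    then have n: "2 \<le> n" using that(1) by (simp add: divide_less_eq)
    note params = probe_count_bounds[OF \<epsilon> True] level_count_bounds(3)[OF \<epsilon> True]
      sample_root_bounds(1,2)[OF \<epsilon> True]
    show ?thesis
      using tester_correct[OF that bit_count_bounds(1)[OF n] params] within_budget_tester True n
      unfolding m_def q_def by auto
  next
    case False
    then show ?thesis using accept_correct[OF that(1,2)] by (intro exI[of _ "Output Accept"]) auto
  qed
  show ?thesis
    using m_le q_le testers by (intro exI[of _ m] exI[of _ q] exI[of _ K] exI[of _ 2]) blast
qed

end
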